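(* Let $(X,\mathcal F)$ be a compact Polish foliated space of class $C^2$, and let $X_0\subset X$ be the union of the leaves without holonomy. With respect to an ergodic quasi-invariant current on $X$ for which $X\setminus X_0$ has zero measure, either (i) almost all leaves are coarsely quasi-isometric to almost all leaves; or else (ii) almost all leaves are coarsely quasi-isometric to almost no leaf.
   Context: Foliated spaces. A foliated structure $\mathcal F$ of class $C^2$ and dimension $n$ on a space $X$ is given by an atlas $\{(U_i,\phi_i)\}$, where $\{U_i\}$ is an open cover of $X$ and $\phi_i:U_i\to B_i\times Z_i$ are homeomorphisms, with $B_i\subset\mathbb R^n$ an open ball and $Z_i$ a locally compact Polish space, whose changes of coordinates are locally of the form $\phi_j\phi_i^{-1}(x,z)=(x_{ij}(x,z),h_{ij}(z))$, where the partial derivatives of $x_{ij}$ up to order $2$ with respect to $x$ exist and are continuous in $(x,z)$. The sets $\phi_i^{-1}(B_i\times\{z\})$ are the plaques; the leaves are the connected components of $X$ with the topology whose basic open sets are the plaques of all foliated charts. $L_x$ is the leaf through $x$. $(X,\mathcal F)$ is compact Polish if $X$ is compact, Hausdorff and second countable. A subset is saturated if it is a union of leaves. Regular atlas and holonomy. A foliated atlas $\mathcal U=\{(U_i,\phi_i)\}$ is regular if: each $(U_i,\phi_i)$ is the restriction of a foliated chart $(\widetilde U_i,\tilde\phi_i)$ with $\overline{U_i}\subset\widetilde U_i$; $\{U_i\}$ is locally finite; and the closure of every plaque of $(U_i,\phi_i)$ meets at most the closure of one plaque of $(U_j,\phi_j)$, for all $i,j$. Let $p_i:U_i\to Z_i$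 be $\phi_i$ followed by the second projection; there are homeomorphisms $h_{ij}:p_i(U_i\cap U_j)\to p_j(U_i\cap U_j)$ with $p_j=h_{ij}p_i$ on $U_i\cap U_j$, generating the holonomy pseudogroup $\mathcal H$ on $\bigsqcup_iZ_i$. The holonomy group of the leaf through $x\in U_i$ is the group of germs at $p_i(x)$ of maps in $\mathcal H$ fixing $p_i(x)$; a leaf is without holonomy if this group is trivial. Leaf metrics. Fix a regular foliated atlas $\mathcal U$. For $x,y$ in the same leaf, $d^*_{\mathcal U}(x,y)=0$ if $x=y$, and otherwise it is the minimum number of $\mathcal U$-plaques whose union is connected and contains $x$ and $y$. Leaves are considered as metric spaces with $d^*_{\mathcal U}$; the notions used do not depend on the choice of $\mathcal U$. For $K\ge0$, $A\subset M$ is a $K$-net in a metric space $M$ if every point of $M$ is at distance $\le K$ from some point of $A$. Metric spaces $M,M'$ are coarsely quasi-isometric if there are $K\ge0$, $C\ge1$ and a bijection $f:A\to A'$ between $K$-nets $A\subset M$, $A'\subset M'$ with $\frac1Cd(x,y)\le d'(f(x),f(y))\le C\,d(x,y)$ for all $x,y\in A$. Quasi-invariant currents. A current $m$ on $(X,\mathcal F)$ is a positive linear functional on the space of compactly supported (leafwise) densities, i.e. sections of the bundle of densities of the leafwise tangent bundle; choosing a positive density, it is identified with a Radon measure on $X$ whose sets of zero measure do not depend on the choice. It is quasi-invariant if, on each foliated chart $\phi:U\to B\times Z$, $\phi_*m$ admits a disintegration $\phi_*m=\int_Z\lambda_z\cdot\mu_Z(z)$, where $\mu_Z$ is a measure on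 $Z$ and, for $\mu_Z$-almost all $z\in Z$, $\lambda_z$ is equivalent to the Lebesgue current on $B\times\{z\}$ (same sets of zero measure). It is ergodic if every saturated measurable set has either zero measure or full measure (complement of zero measure). "Almost all leaves are coarsely quasi-isometric to almost all (respectively, almost no) leaves" means that, for almost every $x\in X$, the set of $y\in X$ such that $L_y$ is coarsely quasi-isometric to $L_x$ has full (respectively, zero) measure. *)

theory Defs
  imports "HOL-Analysis.Analysis"
begin

section \<open>Foliated spaces of class \<open>C\<^sup>2\<close>\<close>

text \<open>A chart is a homeomorphism \<open>fmap\<close> from the open set \<open>fdom\<close> onto the product of the ball
  \<open>fball\<close> and the space \<open>ftrans\<close>. The transversals of the charts of one structure are topologies
  on subsets of a common type \<open>'z\<close>, and may differ from chart to chart.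
  The value of \<open>fmap\<close> outside \<open>fdom\<close> carries no meaning.\<close>

record ('a, 'n::finite, 'z) fchart =
  fdom :: "'a set"
  fball :: "(real^'n) set"
  ftrans :: "'z topology"
  fmap :: "'a \<Rightarrow> (real^'n) \<times> 'z"

definition is_chart :: "('a::topological_space, 'n::finite, 'z) fchart \<Rightarrow> bool" where
  "is_chart C \<longleftrightarrow>
     open (fdom C) \<and>
     (\<exists>c r. r > 0 \<and> fball C = ball c r) \<and>
     completely_metrizable_space (ftrans C) \<and> second_countable (ftrans C) \<and>
     locally_compact_space (ftrans C) \<and>
     homeomorphic_map (top_of_set (fdom C)) (prod_topology (top_of_set (fball C)) (ftrans C))
       (fmap C)"

text \<open>\<open>g\<close> is the partial derivative of \<open>f\<close> on \<open>D\<close> in the \<open>k\<close>-th leafwise coordinate.\<close>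

definition partial_on ::
    "((real^'n) \<times> 'z) set \<Rightarrow> 'n::finite \<Rightarrow> ((real^'n) \<times> 'z \<Rightarrow> real^'n) \<Rightarrow> ((real^'n) \<times> 'z \<Rightarrow> real^'n) \<Rightarrow> bool"
  where
  "partial_on D k f g \<longleftrightarrow>
     (\<forall>(x, z)\<in>D. ((\<lambda>t. f (x + t *\<^sub>R axis k 1, z)) has_vector_derivative g (x, z)) (at 0))"

definition leafwise_C2 ::
    "'z topology \<Rightarrow> ((real^'n) \<times> 'z) set \<Rightarrow> ((real^'n) \<times> 'z \<Rightarrow> real^'n::finite) \<Rightarrow> bool" where
  "leafwise_C2 Z D f \<longleftrightarrow>
     (let T = subtopology (prod_topology euclidean Z) D in
      continuous_map T euclidean f \<and>
      (\<exists>D1 D2. \<forall>k. partial_on D k f (D1 k) \<and> continuous_map T euclidean (D1 k) \<and>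
         (\<forall>l. partial_on D l (D1 k) (D2 k l) \<and> continuous_map T euclidean (D2 k l))))"

definition compatible ::
    "('a::topological_space, 'n::finite, 'z) fchart \<Rightarrow> ('a, 'n, 'z) fchart \<Rightarrow> bool" where
  "compatible C D \<longleftrightarrow>
     (\<forall>p \<in> fdom C \<inter> fdom D. \<exists>W f h. open W \<and> p \<in> W \<and> W \<subseteq> fdom C \<inter> fdom D \<and>
        (\<forall>q\<in>W. fmap D q = (f (fmap C q), h (snd (fmap C q)))) \<and>
        leafwise_C2 (ftrans C) (fmap C ` W) f)"

definition foliated_atlas :: "('a::topological_space, 'n::finite, 'z) fchart set \<Rightarrow> bool" where
  "foliated_atlas \<A> \<longleftrightarrow>
     (\<forall>C\<in>\<A>. is_chart C) \<and> (\<Union>C\<in>\<A>. fdom C) = UNIV \<and> (\<forall>C\<in>\<A>. \<forall>D\<in>\<A>. compatible C D)"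

definition foliated_charts ::
    "('a::topological_space, 'n::finite, 'z) fchart set \<Rightarrow> ('a, 'n, 'z) fchart set" where
  "foliated_charts \<A> = {C. is_chart C \<and> (\<forall>D\<in>\<A>. compatible C D \<and> compatible D C)}"

text \<open>A foliated structure is represented by the set \<open>\<F>\<close> of all its foliated charts, that is, by
  a maximal atlas.\<close>

definition foliated_structure :: "('a::topological_space, 'n::finite, 'z) fchart set \<Rightarrow> bool" where
  "foliated_structure \<F> \<longleftrightarrow> (\<exists>\<A>. foliated_atlas \<A> \<and> \<F> = foliated_charts \<A>)"

definition plaque :: "('a, 'n::finite, 'z) fchart \<Rightarrow> 'z \<Rightarrow> 'a set" where
  "plaque C z = {x \<in> fdom C. snd (fmap C x) = z}"

definition plaques :: "('a, 'n::finite, 'z) fchart \<Rightarrow> 'a set set" where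
  "plaques C = plaque C ` topspace (ftrans C)"

definition leaf_topology :: "('a, 'n::finite, 'z) fchart set \<Rightarrow> 'a topology" where
  "leaf_topology \<F> = topology_generated_by (\<Union>C\<in>\<F>. plaques C)"

definition leaves :: "('a, 'n::finite, 'z) fchart set \<Rightarrow> 'a set set" where
  "leaves \<F> = connected_components_of (leaf_topology \<F>)"

definition leaf :: "('a, 'n::finite, 'z) fchart set \<Rightarrow> 'a \<Rightarrow> 'a set" where
  "leaf \<F> x = connected_component_of_set (leaf_topology \<F>) x"

definition saturated :: "('a, 'n::finite, 'z) fchart set \<Rightarrow> 'a set \<Rightarrow> bool" where
  "saturated \<F> S \<longleftrightarrow> (\<exists>\<L> \<subseteq> leaves \<F>. S = \<Union>\<L>)"


section \<open>Regular atlases and holonomy\<close>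

text \<open>If \<open>C\<close> and \<open>C'\<close> are charts, \<open>fdom C \<subseteq> fdom C'\<close> and \<open>fmap C = fmap C'\<close> on \<open>fdom C\<close>, then
  the ball and the transversal of \<open>C\<close> are automatically subspaces of those of \<open>C'\<close>
  (when \<open>fdom C\<close> is nonempty).\<close>

definition regular_atlas ::
    "('a::topological_space, 'n::finite, 'z) fchart set \<Rightarrow> ('a, 'n, 'z) fchart set \<Rightarrow> bool" where
  "regular_atlas \<F> \<U> \<longleftrightarrow>
     \<U> \<subseteq> \<F> \<and> (\<Union>C\<in>\<U>. fdom C) = UNIV \<and>
     (\<forall>C\<in>\<U>. \<exists>C'\<in>\<F>. closure (fdom C) \<subseteq> fdom C' \<and> (\<forall>x\<in>fdom C. fmap C x = fmap C' x)) \<and>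
     (\<forall>x. \<exists>V. open V \<and> x \<in> V \<and> finite {C\<in>\<U>. fdom C \<inter> V \<noteq> {}}) \<and>
     (\<forall>C\<in>\<U>. \<forall>D\<in>\<U>. \<forall>P\<in>plaques C. \<forall>Q\<in>plaques D. \<forall>Q'\<in>plaques D.
        closure P \<inter> closure Q \<noteq> {} \<longrightarrow> closure P \<inter> closure Q' \<noteq> {} \<longrightarrow> Q = Q')"

text \<open>The disjoint union of the transversals; its points are pairs \<open>(C, z)\<close>.\<close>

definition total_transversal ::
    "('a, 'n::finite, 'z) fchart set \<Rightarrow> (('a, 'n, 'z) fchart \<times> 'z) topology" where
  "total_transversal \<U> = sum_topology ftrans \<U>"

definition transversal_proj ::
    "('a, 'n::finite, 'z) fchart \<Rightarrow> 'a \<Rightarrow> ('a, 'n, 'z) fchart \<times> 'z" where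
  "transversal_proj C x = (C, snd (fmap C x))"

text \<open>Partial homeomorphisms of the total transversal are represented by their graphs. For a regular
  atlas, the following relation is the graph of the map \<open>h\<close> with \<open>p\<^sub>D = h \<circ> p\<^sub>C\<close> on
  \<open>fdom C \<inter> fdom D\<close>.\<close>

definition transition_graph ::
    "('a, 'n::finite, 'z) fchart \<Rightarrow> ('a, 'n, 'z) fchart \<Rightarrow>
     ((('a, 'n, 'z) fchart \<times> 'z) \<times> (('a, 'n, 'z) fchart \<times> 'z)) set" where
  "transition_graph C D =
     {(transversal_proj C x, transversal_proj D x) | x. x \<in> fdom C \<inter> fdom D}"

text \<open>The pseudogroup generated by the transition maps: closed under composition, inversion,
  restriction to open sets, and unions that are again graphs of injective maps.\<close>

inductive_set holonomy_pseudogroup ::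
    "('a, 'n::finite, 'z) fchart set \<Rightarrow>
     ((('a, 'n, 'z) fchart \<times> 'z) \<times> (('a, 'n, 'z) fchart \<times> 'z)) set set"
  for \<U> :: "('a, 'n::finite, 'z) fchart set" where
  transition: "C \<in> \<U> \<Longrightarrow> D \<in> \<U> \<Longrightarrow> transition_graph C D \<in> holonomy_pseudogroup \<U>"
| identity: "Id_on (topspace (total_transversal \<U>)) \<in> holonomy_pseudogroup \<U>"
| composition: "g \<in> holonomy_pseudogroup \<U> \<Longrightarrow> h \<in> holonomy_pseudogroup \<U> \<Longrightarrow>
    g O h \<in> holonomy_pseudogroup \<U>"
| inversion: "g \<in> holonomy_pseudogroup \<U> \<Longrightarrow> g\<inverse> \<in> holonomy_pseudogroup \<U>"
| restriction: "g \<in> holonomy_pseudogroup \<U> \<Longrightarrow> openin (total_transversal \<U>) V \<Longrightarrow>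
    g \<inter> (V \<times> UNIV) \<in> holonomy_pseudogroup \<U>"
| union: "(\<And>g. g \<in> G \<Longrightarrow> g \<in> holonomy_pseudogroup \<U>) \<Longrightarrow>
    single_valued (\<Union>G) \<Longrightarrow> single_valued ((\<Union>G)\<inverse>) \<Longrightarrow> \<Union>G \<in> holonomy_pseudogroup \<U>"

definition holonomy_stabilizer ::
    "('a, 'n::finite, 'z) fchart set \<Rightarrow> ('a, 'n, 'z) fchart \<times> 'z \<Rightarrow>
     ((('a, 'n, 'z) fchart \<times> 'z) \<times> (('a, 'n, 'z) fchart \<times> 'z)) set set" where
  "holonomy_stabilizer \<U> p = {g \<in> holonomy_pseudogroup \<U>. (p, p) \<in> g}"

definition germ_rel ::
    "('a, 'n::finite, 'z) fchart set \<Rightarrow> ('a, 'n, 'z) fchart \<times> 'z \<Rightarrow>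
     (((('a, 'n, 'z) fchart \<times> 'z) \<times> (('a, 'n, 'z) fchart \<times> 'z)) set) rel" where
  "germ_rel \<U> p =
     {(g, h). g \<in> holonomy_stabilizer \<U> p \<and> h \<in> holonomy_stabilizer \<U> p \<and>
        (\<exists>V. openin (total_transversal \<U>) V \<and> p \<in> V \<and> g \<inter> (V \<times> UNIV) = h \<inter> (V \<times> UNIV))}"

text \<open>The underlying set of the holonomy group: only its triviality is needed, so the group law
  (induced by composition) is not made explicit. The neutral element is the germ of the identity.\<close>

definition holonomy_group ::
    "('a, 'n::finite, 'z) fchart set \<Rightarrow> ('a, 'n, 'z) fchart \<times> 'z \<Rightarrow>
     ((('a, 'n, 'z) fchart \<times> 'z) \<times> (('a, 'n, 'z) fchart \<times> 'z)) set set set" where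
  "holonomy_group \<U> p = holonomy_stabilizer \<U> p // germ_rel \<U> p"

definition trivial_holonomy ::
    "('a, 'n::finite, 'z) fchart set \<Rightarrow> ('a, 'n, 'z) fchart \<times> 'z \<Rightarrow> bool" where
  "trivial_holonomy \<U> p \<longleftrightarrow>
     holonomy_group \<U> p = {germ_rel \<U> p `` {Id_on (topspace (total_transversal \<U>))}}"

definition without_holonomy :: "('a, 'n::finite, 'z) fchart set \<Rightarrow> 'a set \<Rightarrow> bool" where
  "without_holonomy \<U> L \<longleftrightarrow>
     (\<forall>C\<in>\<U>. \<forall>x \<in> L \<inter> fdom C. trivial_holonomy \<U> (transversal_proj C x))"

definition leaves_without_holonomy ::
    "('a, 'n::finite, 'z) fchart set \<Rightarrow> ('a, 'n, 'z) fchart set \<Rightarrow> 'a set" where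
  "leaves_without_holonomy \<F> \<U> = \<Union>{L \<in> leaves \<F>. without_holonomy \<U> L}"


section \<open>Leaf metrics and coarse quasi-isometry\<close>

text \<open>Meaningful for \<open>x\<close>, \<open>y\<close> in the same leaf (otherwise the set of candidates \<open>k\<close> is empty).\<close>

definition plaque_dist ::
    "('a, 'n::finite, 'z) fchart set \<Rightarrow> ('a, 'n, 'z) fchart set \<Rightarrow> 'a \<Rightarrow> 'a \<Rightarrow> real" where
  "plaque_dist \<F> \<U> x y =
     (if x = y then 0
      else real (LEAST k. \<exists>\<P>. \<P> \<subseteq> (\<Union>C\<in>\<U>. plaques C) \<and> finite \<P> \<and> card \<P> = k \<and>
             connectedin (leaf_topology \<F>) (\<Union>\<P>) \<and> x \<in> \<Union>\<P> \<and> y \<in> \<Union>\<P>))"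

definition is_net :: "real \<Rightarrow> 'b set \<Rightarrow> ('b \<Rightarrow> 'b \<Rightarrow> real) \<Rightarrow> 'b set \<Rightarrow> bool" where
  "is_net K M d A \<longleftrightarrow> A \<subseteq> M \<and> (\<forall>x\<in>M. \<exists>a\<in>A. d x a \<le> K)"

definition coarsely_quasi_isometric ::
    "'b set \<Rightarrow> ('b \<Rightarrow> 'b \<Rightarrow> real) \<Rightarrow> 'c set \<Rightarrow> ('c \<Rightarrow> 'c \<Rightarrow> real) \<Rightarrow> bool" where
  "coarsely_quasi_isometric M d M' d' \<longleftrightarrow>
     (\<exists>K C A A' f. K \<ge> 0 \<and> C \<ge> 1 \<and> is_net K M d A \<and> is_net K M' d' A' \<and> bij_betw f A A' \<and>
        (\<forall>x\<in>A. \<forall>y\<in>A. (1 / C) * d x y \<le> d' (f x) (f y) \<and> d' (f x) (f y) \<le> C * d x y))"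


section \<open>Leafwise densities and currents\<close>

definition chart_inv :: "('a, 'n::finite, 'z) fchart \<Rightarrow> (real^'n) \<times> 'z \<Rightarrow> 'a" where
  "chart_inv C = inv_into (fdom C) (fmap C)"

text \<open>The Jacobian matrix at \<open>x\<close>, along the leaf, of the change of coordinates from \<open>C\<close> to \<open>D\<close>.\<close>

definition leafwise_jacobian ::
    "('a, 'n::finite, 'z) fchart \<Rightarrow> ('a, 'n, 'z) fchart \<Rightarrow> 'a \<Rightarrow> real^'n^'n" where
  "leafwise_jacobian C D x =
     (\<chi> i k. vector_derivative
        (\<lambda>t. fst (fmap D (chart_inv C (fst (fmap C x) + t *\<^sub>R axis k 1, snd (fmap C x)))))
        (at 0) $ i)"

text \<open>A continuous section \<open>\<sigma>\<close> of the bundle of densities of the leafwise tangent bundle is given by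
  its coefficients: \<open>\<sigma> = \<sigma> C \<cdot> |dx\<^sub>C|\<close> on \<open>fdom C\<close>, where \<open>|dx\<^sub>C|\<close> is the density that corresponds to
  the Lebesgue measure of \<open>\<real>\<^sup>n\<close> in the leafwise coordinates of \<open>C\<close>. The transformation rule
  is \<open>|dx\<^sub>D| = |det (\<partial>x\<^sub>D / \<partial>x\<^sub>C)| |dx\<^sub>C|\<close>.
  The coefficients are set to \<open>0\<close> where they have no meaning, so that the function \<open>\<sigma>\<close> is
  determined by the section.\<close>

type_synonym ('a, 'n, 'z) density = "('a, 'n, 'z) fchart \<Rightarrow> 'a \<Rightarrow> real"

definition is_density ::
    "('a::topological_space, 'n::finite, 'z) fchart set \<Rightarrow> ('a, 'n, 'z) density \<Rightarrow> bool" where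
  "is_density \<F> \<sigma> \<longleftrightarrow>
     (\<forall>C\<in>\<F>. continuous_on (fdom C) (\<sigma> C)) \<and>
     (\<forall>C\<in>\<F>. \<forall>D\<in>\<F>. \<forall>x \<in> fdom C \<inter> fdom D.
        \<sigma> C x = \<bar>det (leafwise_jacobian C D x)\<bar> * \<sigma> D x) \<and>
     (\<forall>C x. C \<notin> \<F> \<or> x \<notin> fdom C \<longrightarrow> \<sigma> C x = 0)"

definition density_support :: "('a::topological_space, 'n::finite, 'z) density \<Rightarrow> 'a set" where
  "density_support \<sigma> = closure {x. \<exists>C. \<sigma> C x \<noteq> 0}"

definition compact_densities ::
    "('a::topological_space, 'n::finite, 'z) fchart set \<Rightarrow> ('a, 'n, 'z) density set" where
  "compact_densities \<F> = {\<sigma>. is_density \<F> \<sigma> \<and> compact (density_support \<sigma>)}"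

definition positive_density ::
    "('a::topological_space, 'n::finite, 'z) fchart set \<Rightarrow> ('a, 'n, 'z) density \<Rightarrow> bool" where
  "positive_density \<F> \<omega> \<longleftrightarrow> is_density \<F> \<omega> \<and> (\<forall>C\<in>\<F>. \<forall>x\<in>fdom C. \<omega> C x > 0)"

definition current ::
    "('a::topological_space, 'n::finite, 'z) fchart set \<Rightarrow> (('a, 'n, 'z) density \<Rightarrow> real) \<Rightarrow> bool"
  where
  "current \<F> m \<longleftrightarrow>
     (\<forall>\<sigma>\<in>compact_densities \<F>. \<forall>\<tau>\<in>compact_densities \<F>.
        m (\<lambda>C x. \<sigma> C x + \<tau> C x) = m \<sigma> + m \<tau>) \<and>
     (\<forall>\<sigma>\<in>compact_densities \<F>. \<forall>c. m (\<lambda>C x. c * \<sigma> C x) = c * m \<sigma>) \<and>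
     (\<forall>\<sigma>\<in>compact_densities \<F>. (\<forall>C x. \<sigma> C x \<ge> 0) \<longrightarrow> m \<sigma> \<ge> 0)"

text \<open>On a locally compact, Hausdorff, second countable space, a Borel measure that is finite on
  compact sets is automatically regular.\<close>

definition radon_measure :: "'a::topological_space measure \<Rightarrow> bool" where
  "radon_measure \<mu> \<longleftrightarrow> sets \<mu> = sets borel \<and> (\<forall>K. compact K \<longrightarrow> emeasure \<mu> K < \<infinity>)"

text \<open>\<open>\<mu>\<close> is the Radon measure identified with the current \<open>m\<close> by means of the positive
  density \<open>\<omega>\<close>.\<close>

definition current_measure ::
    "(('a::topological_space, 'n::finite, 'z) density \<Rightarrow> real) \<Rightarrow> ('a, 'n, 'z) density \<Rightarrow>
     'a measure \<Rightarrow> bool" where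
  "current_measure m \<omega> \<mu> \<longleftrightarrow> radon_measure \<mu> \<and>
     (\<forall>f::'a \<Rightarrow> real. continuous_on UNIV f \<longrightarrow> compact (closure {x. f x \<noteq> 0}) \<longrightarrow>
        has_bochner_integral \<mu> f (m (\<lambda>C x. f x * \<omega> C x)))"

text \<open>The current \<open>\<lambda>\<^sub>z\<close> on the plaque over \<open>z\<close> is identified, by means of the density \<open>|dx\<^sub>C|\<close>, with a
  Radon measure \<open>\<kappa> z\<close> on the ball of \<open>C\<close>; the Lebesgue current is then identified with the
  Lebesgue measure. The disintegration is tested on the densities supported in \<open>fdom C\<close>, whose
  image by the chart is \<open>\<sigma> C (chart_inv C (x, z)) |dx|\<close>.\<close>

definition quasi_invariant ::
    "('a::topological_space, 'n::finite, 'z) fchart set \<Rightarrow> (('a, 'n, 'z) density \<Rightarrow> real) \<Rightarrow> bool"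
  where
  "quasi_invariant \<F> m \<longleftrightarrow>
     (\<forall>C\<in>\<F>. \<exists>(\<nu> :: 'z measure) (\<kappa> :: 'z \<Rightarrow> (real^'n) measure).
        space \<nu> = topspace (ftrans C) \<and>
        sets \<nu> = sigma_sets (topspace (ftrans C)) {S. openin (ftrans C) S} \<and>
        (\<forall>z\<in>topspace (ftrans C).
           sets (\<kappa> z) = sets (restrict_space borel (fball C)) \<and>
           (\<forall>K. compact K \<longrightarrow> K \<subseteq> fball C \<longrightarrow> emeasure (\<kappa> z) K < \<infinity>)) \<and>
        (\<forall>\<sigma>\<in>compact_densities \<F>. density_support \<sigma> \<subseteq> fdom C \<longrightarrow>
           has_bochner_integral \<nu> (\<lambda>z. \<integral>x. \<sigma> C (chart_inv C (x, z)) \<partial>(\<kappa> z)) (m \<sigma>)) \<and>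
        (AE z in \<nu>. null_sets (\<kappa> z) = null_sets (restrict_space lborel (fball C))))"

definition ergodic ::
    "('a::topological_space, 'n::finite, 'z) fchart set \<Rightarrow> 'a measure \<Rightarrow> bool" where
  "ergodic \<F> \<mu> \<longleftrightarrow>
     (\<forall>S\<in>sets \<mu>. saturated \<F> S \<longrightarrow> S \<in> null_sets \<mu> \<or> space \<mu> - S \<in> null_sets \<mu>)"

end

theory Submission
  imports Defs
begin

text \<open>The class of leaves coarsely quasi-isometric to a given leaf is saturated and, for every leaf
  (with or without holonomy), Borel. By ergodicity each class is null or conull. If one class is
  conull, then its members all have this same conull class; otherwise all classes are null.

  To see that the class of \<open>L\<^sub>x\<close> is Borel, name the plaques of \<open>L\<^sub>y\<close> by words in the finitely many
  charts, following chains of plaques from \<open>y\<close>. By regularity of the atlas a word determines a plaque.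
  That a word is realised from \<open>y\<close> is an open condition on \<open>y\<close>, and among such \<open>y\<close> two words ending
  in the same chart name different plaques on an open set, because the transversals are Hausdorff and
  the projections are open; so the leaf metric in terms of words depends on \<open>y\<close> in a Borel way. A
  coarse quasi-isometry between \<open>L\<^sub>x\<close> and \<open>L\<^sub>y\<close> is encoded by a relation between words subject to
  countably many conditions, each involving finitely many pairs of words. By compactness, the existence
  of such a relation amounts to the satisfiability of all finite subsets of the conditions.\<close>

subsection \<open>Coarse correspondences\<close>

definition pseudometric_on :: "'b set \<Rightarrow> ('b \<Rightarrow> 'b \<Rightarrow> real) \<Rightarrow> bool" where
  "pseudometric_on M d \<longleftrightarrow>
     (\<forall>x\<in>M. d x x = 0) \<and> (\<forall>x\<in>M. \<forall>y\<in>M. d x y = d y x) \<and>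
     (\<forall>x\<in>M. \<forall>y\<in>M. \<forall>z\<in>M. d x z \<le> d x y + d y z)"

lemma pseudometric_on_nonneg:
  assumes "pseudometric_on M d" "x \<in> M" "y \<in> M"
  shows "0 \<le> d x y"
proof -
  have "d x x \<le> d x y + d y x" "d x x = 0" "d x y = d y x"
    using assms unfolding pseudometric_on_def by blast+
  then show ?thesis by simp
qed

text \<open>A quasi-isometry given by a relation instead of a bijection between nets, with one
  constant as both slope and additive error. In this form it is easily inverted and composed, and it
  can be encoded by pairs of words.\<close>

definition coarse_correspondence ::
    "real \<Rightarrow> 'b set \<Rightarrow> ('b \<Rightarrow> 'b \<Rightarrow> real) \<Rightarrow> 'c set \<Rightarrow> ('c \<Rightarrow> 'c \<Rightarrow> real) \<Rightarrow> ('b \<times> 'c) set \<Rightarrow> bool"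
  where
  "coarse_correspondence N M d M' d' S \<longleftrightarrow>
     Domain S = M \<and> Range S = M' \<and>
     (\<forall>p p' q q'. (p, p') \<in> S \<longrightarrow> (q, q') \<in> S \<longrightarrow>
        d p q \<le> N * d' p' q' + N \<and> d' p' q' \<le> N * d p q + N)"

lemma coarse_correspondence_mono:
  assumes "coarse_correspondence N M d M' d' S" "N \<le> N'"
    and "pseudometric_on M d" "pseudometric_on M' d'"
  shows "coarse_correspondence N' M d M' d' S"
proof -
  have "d p q \<le> N' * d' p' q' + N' \<and> d' p' q' \<le> N' * d p q + N'"
    if "(p, p') \<in> S" "(q, q') \<in> S" for p p' q q'
  proof -
    have "p \<in> M" "q \<in> M" "p' \<in> M'" "q' \<in> M'"
      using assms(1) that unfolding coarse_correspondence_def by blast+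
    then have "0 \<le> d p q" "0 \<le> d' p' q'"
      using assms(3,4) pseudometric_on_nonneg by metis+
    then have "N * d p q \<le> N' * d p q" "N * d' p' q' \<le> N' * d' p' q'"
      using assms(2) by (auto intro: mult_right_mono)
    moreover have "d p q \<le> N * d' p' q' + N" "d' p' q' \<le> N * d p q + N"
      using assms(1) that unfolding coarse_correspondence_def by blast+
    ultimately show ?thesis using assms(2) by linarith
  qed
  then show ?thesis using assms(1) unfolding coarse_correspondence_def by blast
qed

lemma coarse_correspondence_converse:
  assumes "coarse_correspondence N M d M' d' S"
  shows "coarse_correspondence N M' d' M d (S\<inverse>)"
  using assms unfolding coarse_correspondence_def by auto

lemma coarse_correspondence_comp:
  assumes S: "coarse_correspondence N M d M' d' S" and T: "coarse_correspondence N' M' d' M'' d'' T"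
    and N: "0 \<le> N" "0 \<le> N'"
    and M: "pseudometric_on M d" "pseudometric_on M'' d''"
  shows "coarse_correspondence (N * N' + N + N') M d M'' d'' (S O T)"
proof -
  \<comment> \<open>Composing the two affine estimates gives slope \<open>N * N'\<close> and
    additive errors \<open>N * N' + N\<close> and \<open>N * N' + N'\<close>; \<open>?K\<close>
    dominates all three.\<close>
  let ?K = "N * N' + N + N'"
  have "d p q \<le> ?K * d'' p'' q'' + ?K \<and> d'' p'' q'' \<le> ?K * d p q + ?K"
    if st: "(p, p') \<in> S" "(q, q') \<in> S" "(p', p'') \<in> T" "(q', q'') \<in> T"
    for p q p' q' p'' q''
  proof -
    have "p \<in> M" "q \<in> M" "p'' \<in> M''" "q'' \<in> M''"
      using S T st unfolding coarse_correspondence_def by blast+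
    then have nn: "0 \<le> d p q" "0 \<le> d'' p'' q''"
      using M pseudometric_on_nonneg by metis+
    have 1: "d p q \<le> N * d' p' q' + N" "d' p' q' \<le> N * d p q + N"
      using S st(1,2) unfolding coarse_correspondence_def by blast+
    have 2: "d' p' q' \<le> N' * d'' p'' q'' + N'" "d'' p'' q'' \<le> N' * d' p' q' + N'"
      using T st(3,4) unfolding coarse_correspondence_def by blast+
    have "d p q \<le> N * (N' * d'' p'' q'' + N') + N"
      using 1(1) mult_left_mono[OF 2(1) N(1)] by linarith
    moreover have "d'' p'' q'' \<le> N' * (N * d p q + N) + N'"
      using 2(2) mult_left_mono[OF 1(2) N(2)] by linarith
    moreover have "0 \<le> N * d p q" "0 \<le> N' * d p q" "0 \<le> N * d'' p'' q''" "0 \<le> N' * d'' p'' q''"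
      using nn N by auto
    ultimately show ?thesis using N by (simp add: algebra_simps)
  qed
  moreover have "Domain (S O T) = M" "Range (S O T) = M''"
    using S T unfolding coarse_correspondence_def by blast+
  ultimately show ?thesis unfolding coarse_correspondence_def by blast
qed

text \<open>Zorn's lemma. Since \<open>d\<close> is arbitrary, possibly asymmetric, a point
  \<open>p\<close> that cannot be added may be too close in either order of the arguments.\<close>

lemma maximal_separated_subset:
  fixes d :: "'b \<Rightarrow> 'b \<Rightarrow> real"
  shows "\<exists>A\<subseteq>M. (\<forall>a\<in>A. \<forall>b\<in>A. a \<noteq> b \<longrightarrow> s \<le> d a b) \<and>
    (\<forall>p\<in>M - A. \<exists>a\<in>A. d p a < s \<or> d a p < s)"
proof -
  define \<C> where "\<C> = {A. A \<subseteq> M \<and> (\<forall>a\<in>A. \<forall>b\<in>A. a \<noteq> b \<longrightarrow> s \<le> d a b)}"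
  have "\<exists>A\<in>\<C>. \<forall>B\<in>\<C>. A \<subseteq> B \<longrightarrow> B = A"
  proof (rule subset_Zorn')
    fix \<K> assume K: "subset.chain \<C> \<K>"
    have "s \<le> d a b" if ab: "a \<in> \<Union>\<K>" "b \<in> \<Union>\<K>" "a \<noteq> b" for a b
    proof -
      from ab obtain A B where AB: "A \<in> \<K>" "a \<in> A" "B \<in> \<K>" "b \<in> B" by blast
      then have "A \<subseteq> B \<or> B \<subseteq> A" using K unfolding subset.chain_def by blast
      moreover have "A \<in> \<C>" "B \<in> \<C>" using K AB unfolding subset.chain_def by blast+
      ultimately show ?thesis using AB \<open>a \<noteq> b\<close> unfolding \<C>_def by blast
    qed
    moreover have "\<Union>\<K> \<subseteq> M" using K unfolding subset.chain_def \<C>_def by blast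
    ultimately show "\<Union>\<K> \<in> \<C>" unfolding \<C>_def by blast
  qed
  then obtain A where A: "A \<in> \<C>" and max: "\<And>B. B \<in> \<C> \<Longrightarrow> A \<subseteq> B \<Longrightarrow> B = A" by blast
  have "\<exists>a\<in>A. d p a < s \<or> d a p < s" if p: "p \<in> M" "p \<notin> A" for p
  proof (rule ccontr)
    assume "\<not> ?thesis"
    then have "insert p A \<in> \<C>" using A p unfolding \<C>_def by force
    then have "insert p A = A" using max by blast
    then show False using p by blast
  qed
  moreover have "A \<subseteq> M" "\<forall>a\<in>A. \<forall>b\<in>A. a \<noteq> b \<longrightarrow> s \<le> d a b"
    using A unfolding \<C>_def by blast+
  ultimately show ?thesis by (intro exI[of _ A]) simp
qed

text \<open>Two points correspond when they lie within \<open>K\<close> of net points matched by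
  \<open>f\<close>; the net property makes this relation total on both sides.\<close>

lemma coarsely_quasi_isometric_imp_coarse_correspondence:
  assumes M: "pseudometric_on M d" "pseudometric_on M' d'"
    and qi: "coarsely_quasi_isometric M d M' d'"
  obtains N :: nat and S where "coarse_correspondence (real N) M d M' d' S"
proof -
  have z: "d p p = 0" if "p \<in> M" for p using that M unfolding pseudometric_on_def by blast
  have z': "d' p p = 0" if "p \<in> M'" for p using that M unfolding pseudometric_on_def by blast
  have sym: "d p q = d q p" if "p \<in> M" "q \<in> M" for p q
    using that M unfolding pseudometric_on_def by blast
  have sym': "d' p q = d' q p" if "p \<in> M'" "q \<in> M'" for p q
    using that M unfolding pseudometric_on_def by blast
  have tri: "d p q \<le> d p a + d a b + d q b" if "p \<in> M" "q \<in> M" "a \<in> M" "b \<in> M" for p q a b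
  proof -
    have "d p q \<le> d p a + d a q" "d a q \<le> d a b + d b q" "d b q = d q b"
      using that M unfolding pseudometric_on_def by blast+
    then show ?thesis by simp
  qed
  have tri': "d' p q \<le> d' p a + d' a b + d' q b" if "p \<in> M'" "q \<in> M'" "a \<in> M'" "b \<in> M'" for p q a b
  proof -
    have "d' p q \<le> d' p a + d' a q" "d' a q \<le> d' a b + d' b q" "d' b q = d' q b"
      using that M unfolding pseudometric_on_def by blast+
    then show ?thesis by simp
  qed
  obtain K C A A' f where K: "K \<ge> 0" and C: "C \<ge> 1" and A: "is_net K M d A"
    and A': "is_net K M' d' A'" and f: "bij_betw f A A'"
    and bil: "\<And>x y. x \<in> A \<Longrightarrow> y \<in> A \<Longrightarrow>
      (1 / C) * d x y \<le> d' (f x) (f y) \<and> d' (f x) (f y) \<le> C * d x y"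
    using qi unfolding coarsely_quasi_isometric_def by blast
  have sub: "A \<subseteq> M" "A' \<subseteq> M'" and net: "\<And>x. x \<in> M \<Longrightarrow> \<exists>a\<in>A. d x a \<le> K"
    "\<And>x. x \<in> M' \<Longrightarrow> \<exists>a\<in>A'. d' x a \<le> K"
    using A A' unfolding is_net_def by blast+
  have fA: "f a \<in> A'" if "a \<in> A" for a using f that unfolding bij_betw_def by blast
  \<comment> \<open>Passing to net points, across \<open>f\<close> and back gives slope
    \<open>C\<close> and additive error \<open>2 * K + 2 * K * C\<close>; \<open>N\<close> dominates
    both.\<close>
  define N where "N = nat \<lceil>2 * K + 2 * K * C + C\<rceil>"
  have N: "2 * K + 2 * K * C + C \<le> real N" unfolding N_def by linarith
  define S where "S = {(p, p'). p \<in> M \<and> p' \<in> M' \<and> (\<exists>a\<in>A. d p a \<le> K \<and> d' p' (f a) \<le> K)}"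
  have "p \<in> Domain S" if p: "p \<in> M" for p
  proof -
    obtain a where a: "a \<in> A" "d p a \<le> K" using net p by blast
    then have "(p, f a) \<in> S" using p fA sub K z' unfolding S_def by force
    then show ?thesis by blast
  qed
  moreover have "p' \<in> Range S" if p': "p' \<in> M'" for p'
  proof -
    obtain a' where a': "a' \<in> A'" "d' p' a' \<le> K" using net p' by blast
    then obtain a where "a \<in> A" "a' = f a" using f unfolding bij_betw_def by blast
    then have "(a, p') \<in> S" using a' p' sub K z unfolding S_def by force
    then show ?thesis by blast
  qed
  moreover have "d p q \<le> N * d' p' q' + N \<and> d' p' q' \<le> N * d p q + N"
    if pq: "(p, p') \<in> S" "(q, q') \<in> S" for p p' q q'
  proof -
    from pq obtain a b where ab: "a \<in> A" "d p a \<le> K" "d' p' (f a) \<le> K"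
        "b \<in> A" "d q b \<le> K" "d' q' (f b) \<le> K"
      unfolding S_def by blast
    have mem: "p \<in> M" "q \<in> M" "p' \<in> M'" "q' \<in> M'" "a \<in> M" "b \<in> M" "f a \<in> M'" "f b \<in> M'"
      using pq ab fA sub unfolding S_def by blast+
    have nn: "0 \<le> d p q" "0 \<le> d' p' q'" using mem M pseudometric_on_nonneg by metis+
    have "d a b \<le> d a p + d p q + d b q" "d' (f a) (f b) \<le> d' (f a) p' + d' p' q' + d' (f b) q'"
      using tri tri' mem by blast+
    then have 1: "d a b \<le> d p q + 2 * K" "d' (f a) (f b) \<le> d' p' q' + 2 * K"
      using ab sym[OF mem(5,1)] sym[OF mem(6,2)] sym'[OF mem(7,3)] sym'[OF mem(8,4)]
      by linarith+
    have 2: "d p q \<le> d a b + 2 * K" "d' p' q' \<le> d' (f a) (f b) + 2 * K"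
      using tri[of p q a b] tri'[of p' q' "f a" "f b"] mem ab by linarith+
    have 3: "d a b \<le> C * d' (f a) (f b)" "d' (f a) (f b) \<le> C * d a b"
      using bil[OF ab(1,4)] C by (auto simp: field_simps)
    have 4: "C * d' (f a) (f b) \<le> C * (d' p' q' + 2 * K)" "C * d a b \<le> C * (d p q + 2 * K)"
      using 1 C by (auto intro: mult_left_mono)
    have "0 \<le> 2 * K * C" using K C by simp
    then have "C \<le> N" "2 * K + 2 * K * C \<le> N" using N K C by linarith+
    moreover from this have "C * d p q \<le> N * d p q" "C * d' p' q' \<le> N * d' p' q'"
      using nn mult_right_mono by blast+
    ultimately show ?thesis using 2 3 4 by (simp add: algebra_simps)
  qed
  ultimately have "coarse_correspondence (real N) M d M' d' S"
    unfolding coarse_correspondence_def by (auto simp: S_def)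
  then show ?thesis using that by blast
qed

text \<open>On a maximal \<open>2 * N\<close>-separated set the additive error is absorbed by
  doubling the slope, so any choice \<open>f\<close> of partners under \<open>S\<close> is
  bi-Lipschitz and injective there. Maximality makes the set a net, and \<open>S\<close> carries
  this over to its image.\<close>

lemma coarse_correspondence_imp_coarsely_quasi_isometric:
  assumes M: "pseudometric_on M d" "pseudometric_on M' d'"
    and N: "1 \<le> N" and S: "coarse_correspondence N M d M' d' S"
  shows "coarsely_quasi_isometric M d M' d'"
proof -
  have z: "d p p = 0" if "p \<in> M" for p using that M unfolding pseudometric_on_def by blast
  have z': "d' p p = 0" if "p \<in> M'" for p using that M unfolding pseudometric_on_def by blast
  have sym: "d p q = d q p" if "p \<in> M" "q \<in> M" for p q
    using that M unfolding pseudometric_on_def by blast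
  have sym': "d' p q = d' q p" if "p \<in> M'" "q \<in> M'" for p q
    using that M unfolding pseudometric_on_def by blast
  have dom: "Domain S = M" and ran: "Range S = M'"
    and cor: "\<And>p p' q q'. (p, p') \<in> S \<Longrightarrow> (q, q') \<in> S \<Longrightarrow>
        d p q \<le> N * d' p' q' + N \<and> d' p' q' \<le> N * d p q + N"
    using S unfolding coarse_correspondence_def by blast+
  obtain A where A: "A \<subseteq> M" and sep: "\<And>a b. a \<in> A \<Longrightarrow> b \<in> A \<Longrightarrow> a \<noteq> b \<Longrightarrow> 2 * N \<le> d a b"
    and max: "\<And>p. p \<in> M \<Longrightarrow> p \<notin> A \<Longrightarrow> \<exists>a\<in>A. d p a < 2 * N \<or> d a p < 2 * N"
    using maximal_separated_subset[of M "2 * N" d] by (metis DiffI)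
  have near: "\<exists>a\<in>A. d p a \<le> 2 * N" if "p \<in> M" for p
  proof (cases "p \<in> A")
    case True
    then show ?thesis using z[OF that] N by force
  next
    case False
    then show ?thesis using max[OF that False] sym that A by (metis less_imp_le subsetD)
  qed
  have "\<forall>a\<in>A. \<exists>a'. (a, a') \<in> S" using A dom by blast
  then obtain f where f: "\<And>a. a \<in> A \<Longrightarrow> (a, f a) \<in> S" by metis
  have bil: "(1 / (2 * N)) * d a b \<le> d' (f a) (f b) \<and> d' (f a) (f b) \<le> (2 * N) * d a b"
    if "a \<in> A" "b \<in> A" for a b
  proof (cases "a = b")
    case True
    have "a \<in> M" "f a \<in> M'" using that f A ran by blast+
    then show ?thesis using True z z' by simp
  next
    case False
    then have ab: "2 * N \<le> d a b" using sep that by blast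
    have "d a b \<le> N * d' (f a) (f b) + N" "d' (f a) (f b) \<le> N * d a b + N"
      using cor f that by blast+
    \<comment> \<open>This absorbs the error of the upper bound. For the lower bound,
      \<open>2 * N \<le> d a b \<le> N * d' (f a) (f b) + N\<close> forces
      \<open>N \<le> N * d' (f a) (f b)\<close>.\<close>
    moreover have "N * 1 \<le> N * d a b" using ab N by (intro mult_left_mono) auto
    moreover have "(2 * N) * d a b = N * d a b + N * d a b" by simp
    moreover have "(1 / (2 * N)) * d a b \<le> d' (f a) (f b) \<longleftrightarrow> d a b \<le> N * d' (f a) (f b) + N * d' (f a) (f b)"
      using N by (simp add: field_simps)
    ultimately show ?thesis using ab by linarith
  qed
  have inj: "inj_on f A"
  proof (rule inj_onI)
    fix a b assume ab: "a \<in> A" "b \<in> A" "f a = f b"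
    then have "f a \<in> M'" using f ran by blast
    then have "(1 / (2 * N)) * d a b \<le> 0" using bil[OF ab(1,2)] ab z' by auto
    then have "d a b \<le> 0" using N by (simp add: field_simps mult_le_0_iff)
    then show "a = b" using sep[OF ab(1,2)] N by linarith
  qed
  \<comment> \<open>The image of \<open>A\<close> is a net of radius \<open>N * (2 * N) + N\<close>,
    and \<open>A\<close> one of radius \<open>2 * N\<close>; a single \<open>K\<close> has to serve
    both.\<close>
  define K where "K = 2 * N * N + 2 * N"
  have K: "2 * N \<le> K" unfolding K_def using N by simp
  have "is_net K M d A" unfolding is_net_def using A near K by (meson order_trans)
  moreover have "is_net K M' d' (f ` A)"
  proof -
    have "\<exists>a'\<in>f ` A. d' p' a' \<le> K" if p': "p' \<in> M'" for p'
    proof -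
      obtain p where p: "(p, p') \<in> S" using p' ran by blast
      then have "p \<in> M" using dom by blast
      then obtain a where a: "a \<in> A" "d p a \<le> 2 * N" using near by blast
      have "d' p' (f a) \<le> N * d p a + N" using cor p f a by blast
      moreover have "N * d p a \<le> N * (2 * N)" using a N by (intro mult_left_mono) auto
      moreover have "N * (2 * N) = 2 * N * N" by simp
      ultimately have "d' p' (f a) \<le> K" using N unfolding K_def by linarith
      then show ?thesis using a by blast
    qed
    moreover have "f ` A \<subseteq> M'" using f ran by blast
    ultimately show ?thesis unfolding is_net_def by blast
  qed
  moreover have "bij_betw f A (f ` A)" using inj by (simp add: bij_betw_def)
  moreover have "0 \<le> K" "1 \<le> 2 * N" using K N by linarith+
  ultimately show ?thesis unfolding coarsely_quasi_isometric_def using bil by blast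
qed

text \<open>The constant is natural so that the coarse type becomes a countable union in the
  measurability argument.\<close>

lemma coarsely_quasi_isometric_iff:
  assumes M: "pseudometric_on M d" "pseudometric_on M' d'"
  shows "coarsely_quasi_isometric M d M' d' \<longleftrightarrow>
    (\<exists>N::nat. \<exists>S. coarse_correspondence (real N) M d M' d' S)"
proof
  assume "\<exists>N::nat. \<exists>S. coarse_correspondence (real N) M d M' d' S"
  then obtain N :: nat and S where "coarse_correspondence (real N) M d M' d' S"
    by (elim exE)
  \<comment> \<open>\<open>Suc N\<close> secures the lower bound 1 under which the nets are
    constructed.\<close>
  then have "coarse_correspondence (real (Suc N)) M d M' d' S"
    by (rule coarse_correspondence_mono) (simp_all add: M)
  moreover have "1 \<le> real (Suc N)" by simp
  ultimately show "coarsely_quasi_isometric M d M' d'"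
    by (intro coarse_correspondence_imp_coarsely_quasi_isometric[OF M])
next
  assume "coarsely_quasi_isometric M d M' d'"
  with M show "\<exists>N::nat. \<exists>S. coarse_correspondence (real N) M d M' d' S"
    by (rule coarsely_quasi_isometric_imp_coarse_correspondence) (intro exI)
qed

lemma coarsely_quasi_isometric_sym:
  assumes M: "pseudometric_on M d" "pseudometric_on M' d'"
    and "coarsely_quasi_isometric M d M' d'"
  shows "coarsely_quasi_isometric M' d' M d"
  using assms(3) unfolding coarsely_quasi_isometric_iff[OF M] coarsely_quasi_isometric_iff[OF M(2,1)]
  by (blast intro: coarse_correspondence_converse)

text \<open>Correspondences compose as relations, whereas composing bijections between nets would
  first require matching two different nets of \<open>M'\<close>.\<close>

lemma coarsely_quasi_isometric_trans:
  assumes M: "pseudometric_on M d" "pseudometric_on M' d'" "pseudometric_on M'' d''"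
    and "coarsely_quasi_isometric M d M' d'" "coarsely_quasi_isometric M' d' M'' d''"
  shows "coarsely_quasi_isometric M d M'' d''"
proof -
  obtain N N' :: nat and S T where
    "coarse_correspondence (real N) M d M' d' S" "coarse_correspondence (real N') M' d' M'' d'' T"
    using assms(4,5) coarsely_quasi_isometric_iff[OF M(1,2)] coarsely_quasi_isometric_iff[OF M(2,3)]
    by blast
  then have "coarse_correspondence (real N * real N' + real N + real N') M d M'' d'' (S O T)"
    by (rule coarse_correspondence_comp) (simp_all add: M)
  then have "coarse_correspondence (real (N * N' + N + N')) M d M'' d'' (S O T)" by simp
  then show ?thesis using coarsely_quasi_isometric_iff[OF M(1,3)] by blast
qed

text \<open>Serves to replace the plaque metric by the walk metric, which are compared only for
  points of one leaf.\<close>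

lemma coarsely_quasi_isometric_cong:
  assumes "coarsely_quasi_isometric M d M' d'"
    and d: "\<And>x y. x \<in> M \<Longrightarrow> y \<in> M \<Longrightarrow> e x y = d x y"
    and d': "\<And>x y. x \<in> M' \<Longrightarrow> y \<in> M' \<Longrightarrow> e' x y = d' x y"
  shows "coarsely_quasi_isometric M e M' e'"
proof -
  obtain K C A A' f where KC: "K \<ge> 0" "C \<ge> 1" and A: "is_net K M d A"
    and A': "is_net K M' d' A'" and f: "bij_betw f A A'"
    and bil: "\<forall>x\<in>A. \<forall>y\<in>A. (1 / C) * d x y \<le> d' (f x) (f y) \<and> d' (f x) (f y) \<le> C * d x y"
    using assms(1) unfolding coarsely_quasi_isometric_def by blast
  have sub: "A \<subseteq> M" "A' \<subseteq> M'" using A A' unfolding is_net_def by blast+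
  have "is_net K M e A" using A d sub(1) unfolding is_net_def by (metis subsetD)
  moreover have "is_net K M' e' A'" using A' d' sub(2) unfolding is_net_def by (metis subsetD)
  moreover have "f x \<in> M'" if "x \<in> A" for x
    using bij_betwE[OF f] sub(2) that by blast
  then have "\<forall>x\<in>A. \<forall>y\<in>A. (1 / C) * e x y \<le> e' (f x) (f y) \<and> e' (f x) (f y) \<le> C * e x y"
    using bil d d' sub(1) by (simp add: subset_iff)
  ultimately show ?thesis using KC f unfolding coarsely_quasi_isometric_def by blast
qed

subsection \<open>Compactness and measurability\<close>

text \<open>Subsets are points of a product of copies of the discrete space \<open>bool\<close>,
  compact by Tychonoff. A condition that reads only the finite set \<open>F k\<close> defines a
  closed set there, and the finite intersection property yields a common solution.\<close>

lemma compactness_subsets: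
  fixes P :: "'k \<Rightarrow> 'v set \<Rightarrow> bool"
  assumes fin: "\<And>k. finite (F k)" and dep: "\<And>k R. P k R = P k (R \<inter> F k)"
    and sat: "\<And>K. finite K \<Longrightarrow> \<exists>R. \<forall>k\<in>K. P k R"
  shows "\<exists>R. \<forall>k. P k R"
proof -
  define T where "T = product_topology (\<lambda>_::'v. discrete_topology (UNIV::bool set)) UNIV"
  define B where "B k = {g::'v \<Rightarrow> bool. P k (Collect g)}" for k
  have top: "topspace T = UNIV" unfolding T_def by (simp add: PiE_def)
  have "compact_space T" unfolding T_def
    by (simp add: compact_space_product_topology compact_space_discrete_topology)
  moreover have "closedin T (B k)" for k
  proof -
    have "openin T (- B k)"
    proof (subst openin_subopen, intro ballI)
      fix g assume g: "g \<in> - B k"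
      \<comment> \<open>The cylinder of all functions that agree with \<open>g\<close> on
        \<open>F k\<close>; the truth value of the condition is constant on it.\<close>
      define W where "W = (\<Pi>\<^sub>E v\<in>UNIV. if v \<in> F k then {g v} else UNIV)"
      have "openin T W" unfolding T_def W_def
        by (rule product_topology_basis)
          (auto intro: finite_subset[OF _ fin[of k]])
      moreover have "g \<in> W" unfolding W_def by auto
      moreover have "W \<subseteq> - B k"
      proof
        fix h assume "h \<in> W"
        then have "Collect h \<inter> F k = Collect g \<inter> F k"
          unfolding W_def by (auto simp: PiE_iff split: if_splits)
        then have "P k (Collect h) = P k (Collect g)" using dep by metis
        then show "h \<in> - B k" using g unfolding B_def by simp
      qed
      ultimately show "\<exists>W. openin T W \<and> g \<in> W \<and> W \<subseteq> - B k" by blast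
    qed
    then show ?thesis unfolding closedin_def by (simp add: top Compl_eq_Diff_UNIV)
  qed
  moreover have "\<Inter>\<G> \<noteq> {}" if G: "finite \<G>" "\<G> \<subseteq> range B" for \<G>
  proof -
    obtain K where K: "finite K" "\<G> = B ` K" using G by (meson finite_subset_image)
    then obtain R where "\<forall>k\<in>K. P k R" using sat by blast
    then have "(\<lambda>v. v \<in> R) \<in> \<Inter>\<G>" unfolding K(2) B_def by simp
    then show ?thesis by blast
  qed
  ultimately have "\<Inter>(range B) \<noteq> {}"
    using compact_space_fip[of T] by (metis (no_types, lifting) imageE)
  then show ?thesis unfolding B_def by blast
qed

text \<open>The subsets \<open>R\<close> may be uncountably many. Compactness trades the quantifier
  over them for one over the countably many finite sets \<open>K\<close> of conditions and, for each
  \<open>K\<close>, over the finitely many traces of \<open>R\<close> on the coordinates that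
  \<open>K\<close> reads.\<close>

lemma measurable_ex_subset:
  fixes P :: "'k::countable \<Rightarrow> 'y \<Rightarrow> 'v set \<Rightarrow> bool"
  assumes fin: "\<And>k. finite (F k)" and dep: "\<And>k y R. P k y R = P k y (R \<inter> F k)"
    and meas: "\<And>k R. {y \<in> space M. P k y R} \<in> sets M"
  shows "{y \<in> space M. \<exists>R. \<forall>k. P k y R} \<in> sets M"
proof -
  let ?\<K> = "{K::'k set. finite K}"
  have eq: "(\<exists>R. \<forall>k. P k y R) \<longleftrightarrow> (\<forall>K\<in>?\<K>. \<exists>R\<in>Pow (\<Union>k\<in>K. F k). \<forall>k\<in>K. P k y R)" for y
  proof
    assume "\<exists>R. \<forall>k. P k y R"
    then obtain R where R: "\<And>k. P k y R" by blast
    show "\<forall>K\<in>?\<K>. \<exists>R\<in>Pow (\<Union>k\<in>K. F k). \<forall>k\<in>K. P k y R"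
    proof (intro ballI bexI[of _ "R \<inter> (\<Union>k\<in>_. F k)"])
      fix K k assume "k \<in> (K :: 'k set)"
      then have "R \<inter> (\<Union>k\<in>K. F k) \<inter> F k = R \<inter> F k" by blast
      then show "P k y (R \<inter> (\<Union>k\<in>K. F k))" using R dep by metis
    qed auto
  next
    assume *: "\<forall>K\<in>?\<K>. \<exists>R\<in>Pow (\<Union>k\<in>K. F k). \<forall>k\<in>K. P k y R"
    show "\<exists>R. \<forall>k. P k y R"
    proof (rule compactness_subsets[where F = F and P = "\<lambda>k. P k y"])
      show "\<exists>R. \<forall>k\<in>K. P k y R" if "finite K" for K using * that by blast
    qed (use fin dep in blast)+
  qed
  have "countable ?\<K>" using countable_Collect_finite .
  moreover have "{y \<in> space M. \<exists>R\<in>Pow (\<Union>k\<in>K. F k). \<forall>k\<in>K. P k y R} \<in> sets M" if "K \<in> ?\<K>" for K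
  proof -
    have "{y \<in> space M. \<forall>k\<in>K. P k y R} \<in> sets M" for R
      using that meas by (intro sets.sets_Collect_finite_All) auto
    then show ?thesis using that fin by (intro sets.sets_Collect_finite_Ex) auto
  qed
  ultimately show ?thesis unfolding eq by (intro sets.sets_Collect_countable_All')
qed

subsection \<open>Walks\<close>

text \<open>Used with two alphabets: numbers of charts, where a step stays in one plaque of that
  chart, and sets, where a word is a chain of sets (see \<open>both_in\<close>).\<close>

primrec walk :: "('i \<Rightarrow> 'a \<Rightarrow> 'a \<Rightarrow> bool) \<Rightarrow> 'i list \<Rightarrow> 'a \<Rightarrow> 'a \<Rightarrow> bool" where
  "walk r [] x y \<longleftrightarrow> x = y"
| "walk r (i # w) x y \<longleftrightarrow> (\<exists>z. r i x z \<and> walk r w z y)"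

definition orbit :: "('i \<Rightarrow> 'a \<Rightarrow> 'a \<Rightarrow> bool) \<Rightarrow> 'a \<Rightarrow> 'a set" where
  "orbit r x = {y. \<exists>w. walk r w x y}"

definition walk_dist :: "('i \<Rightarrow> 'a \<Rightarrow> 'a \<Rightarrow> bool) \<Rightarrow> 'a \<Rightarrow> 'a \<Rightarrow> nat" where
  "walk_dist r x y = (LEAST n. \<exists>w. length w = n \<and> walk r w x y)"

lemma walk_append: "walk r (u @ v) x y \<longleftrightarrow> (\<exists>z. walk r u x z \<and> walk r v z y)"
  by (induction u arbitrary: x) auto

lemma walk_rev:
  assumes "\<And>i x y. r i x y \<Longrightarrow> r i y x"
  shows "walk r w x y \<Longrightarrow> walk r (rev w) y x"
  by (induction w arbitrary: x) (auto simp: walk_append intro: assms)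

lemma orbit_refl: "x \<in> orbit r x"
  unfolding orbit_def by (auto intro: exI[of _ "[]"])

lemma orbit_trans: "y \<in> orbit r x \<Longrightarrow> z \<in> orbit r y \<Longrightarrow> z \<in> orbit r x"
  unfolding orbit_def mem_Collect_eq by (metis walk_append)

lemma orbit_sym:
  assumes "\<And>i x y. r i x y \<Longrightarrow> r i y x"
  shows "y \<in> orbit r x \<Longrightarrow> x \<in> orbit r y"
  unfolding orbit_def using walk_rev[of r] assms by blast

lemma orbit_eq:
  assumes "\<And>i x y. r i x y \<Longrightarrow> r i y x" and "y \<in> orbit r x"
  shows "orbit r y = orbit r x"
  using orbit_sym[of r, OF assms] orbit_trans assms(2) by fast

lemma walk_dist_le: "walk r w x y \<Longrightarrow> walk_dist r x y \<le> length w"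
  unfolding walk_dist_def by (blast intro: Least_le)

lemma shortest_walk:
  assumes "y \<in> orbit r x"
  obtains w where "walk r w x y" "length w = walk_dist r x y"
proof -
  have "\<exists>n w. length w = n \<and> walk r w x y" using assms unfolding orbit_def by blast
  from LeastI_ex[OF this] show ?thesis using that unfolding walk_dist_def by blast
qed

lemma walk_dist_refl: "walk_dist r x x = 0"
  using walk_dist_le[of r "[]" x x] by simp

lemma walk_dist_triangle:
  assumes "y \<in> orbit r x" "z \<in> orbit r y"
  shows "walk_dist r x z \<le> walk_dist r x y + walk_dist r y z"
proof -
  obtain u v where "walk r u x y" "length u = walk_dist r x y"
    "walk r v y z" "length v = walk_dist r y z"
    using assms by (metis shortest_walk)
  then have "walk r (u @ v) x z" "length (u @ v) = walk_dist r x y + walk_dist r y z"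
    by (auto simp: walk_append)
  then show ?thesis using walk_dist_le by metis
qed

lemma walk_dist_sym:
  assumes r: "\<And>i x y. r i x y \<Longrightarrow> r i y x" and "y \<in> orbit r x"
  shows "walk_dist r x y = walk_dist r y x"
proof -
  have "walk_dist r b a \<le> walk_dist r a b" if "b \<in> orbit r a" for a b
  proof -
    obtain w where "walk r w a b" "length w = walk_dist r a b" using shortest_walk \<open>b \<in> orbit r a\<close> .
    moreover from this have "walk r (rev w) b a" using walk_rev[of r] r by blast
    ultimately show ?thesis using walk_dist_le[of r "rev w"] by simp
  qed
  then show ?thesis using assms(2) orbit_sym[of r, OF r assms(2)] by (simp add: order_antisym)
qed

lemma pseudometric_on_orbit:
  assumes r: "\<And>i x y. r i x y \<Longrightarrow> r i y x"
  shows "pseudometric_on (orbit r x) (\<lambda>p q. real (walk_dist r p q))"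
proof -
  have rel: "q \<in> orbit r p" if "p \<in> orbit r x" "q \<in> orbit r x" for p q
    using that orbit_eq[of r, OF r] by metis
  show ?thesis unfolding pseudometric_on_def
  proof (intro conjI ballI)
    fix p q s assume "p \<in> orbit r x" "q \<in> orbit r x" "s \<in> orbit r x"
    then show "real (walk_dist r p s) \<le> real (walk_dist r p q) + real (walk_dist r q s)"
      using walk_dist_triangle[of q r p s] rel by (simp flip: of_nat_add)
  qed (use walk_dist_sym[of r, OF r] rel in \<open>auto simp: walk_dist_refl\<close>)
qed

subsection \<open>Borel dependence of the coarse type of an orbit on the base point\<close>

text \<open>\<open>r i\<close> stands for lying in the same plaque of chart \<open>i\<close>, a
  partial equivalence relation whose domain is that chart. \<open>r_open\<close> reflects that the
  projection to the transversal is open and continuous, \<open>r_holonomy\<close> the regularity of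
  the atlas, \<open>r_separated\<close> the Hausdorff property of the transversal.\<close>

locale plaque_relations =
  fixes r :: "nat \<Rightarrow> 'a::topological_space \<Rightarrow> 'a \<Rightarrow> bool" and m :: nat
  assumes r_bound: "r i x y \<Longrightarrow> i < m"
    and r_sym: "r i x y \<Longrightarrow> r i y x"
    and r_trans: "r i x y \<Longrightarrow> r i y z \<Longrightarrow> r i x z"
    and r_cover: "\<exists>i. r i x x"
    and r_open: "open V \<Longrightarrow> open {x. \<exists>y\<in>V. r i x y}"
    and r_holonomy: "r i p q \<Longrightarrow> r j p p' \<Longrightarrow> r j q q' \<Longrightarrow> r j p' q'"
    and r_separated: "r i p p \<Longrightarrow> r i q q \<Longrightarrow> \<not> r i p q \<Longrightarrow>
      \<exists>V W. open V \<and> open W \<and> p \<in> V \<and> q \<in> W \<and> (\<forall>p'\<in>V. \<forall>q'\<in>W. \<not> r i p' q')"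
begin

section \<open>Words as names of plaques\<close>

lemma open_walk: "open V \<Longrightarrow> open {x. \<exists>y\<in>V. walk r w x y}"
proof (induction w)
  case (Cons i w)
  have "{x. \<exists>y\<in>V. walk r (i # w) x y} = {x. \<exists>z\<in>{z. \<exists>y\<in>V. walk r w z y}. r i x z}" by auto
  then show ?case using r_open[OF Cons.IH[OF Cons.prems]] by simp
qed simp

lemma walk_set: "walk r w x y \<Longrightarrow> set w \<subseteq> {..<m}"
  by (induction w arbitrary: x) (auto dest: r_bound)

text \<open>Single-valuedness of the holonomy: the ends of the walks along a fixed word form one plaque,
  so nonempty words are names for the plaques of the orbit.\<close>

lemma walk_end_unique: "walk r (w @ [i]) x p \<Longrightarrow> walk r (w @ [i]) x q \<Longrightarrow> r i p q"
proof (induction w arbitrary: i p q rule: rev_induct)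
  case Nil
  then show ?case by (auto intro: r_sym r_trans)
next
  case (snoc j w)
  then obtain p1 q1 where "walk r (w @ [j]) x p1" "r i p1 p" "walk r (w @ [j]) x q1" "r i q1 q"
    by (auto simp: walk_append[of r "w @ [j]" "[i]", simplified])
  then show ?case using snoc.IH r_holonomy by blast
qed

lemma walk_end_closed: "walk r (w @ [i]) x p \<Longrightarrow> r i p q \<Longrightarrow> walk r (w @ [i]) x q"
  by (auto simp: walk_append intro: r_trans)

lemma walk_end_refl: "walk r (w @ [i]) x p \<Longrightarrow> r i p p"
  by (auto simp: walk_append intro: r_sym r_trans)

text \<open>For words with the same last letter this says that they name the same plaque; for other
  nonempty words, that the plaques they name intersect.\<close>

definition meets :: "'a \<Rightarrow> nat list \<Rightarrow> nat list \<Rightarrow> bool" where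
  "meets x v w \<longleftrightarrow> (\<exists>p. walk r v x p \<and> walk r w x p)"

text \<open>A difference of open sets. Both words being realised from \<open>x\<close> is an open
  condition; given this, they name different plaques of chart \<open>i\<close> exactly on
  \<open>apart\<close>, which is open because unrelated points have unrelated
  neighbourhoods.\<close>

lemma measurable_meets_snoc: "{x. meets x (v @ [i]) (w @ [i])} \<in> sets borel"
proof -
  define dom where "dom u = {x. \<exists>y\<in>UNIV. walk r (u @ [i]) x y}" for u
  define \<S> where "\<S> = {(V, W). open V \<and> open W \<and> (\<forall>p\<in>V. \<forall>q\<in>W. \<not> r i p q)}"
  define apart where "apart = (\<Union>(V, W)\<in>\<S>. {x. \<exists>p\<in>V. walk r (v @ [i]) x p} \<inter>
    {x. \<exists>q\<in>W. walk r (w @ [i]) x q})"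
  have "open (dom u)" for u unfolding dom_def by (intro open_walk) simp
  moreover have "open apart" unfolding apart_def \<S>_def
    by (intro open_UN ballI) (auto intro!: open_Int open_walk)
  ultimately have "dom v \<inter> dom w - apart \<in> sets borel" by auto
  moreover have "{x. meets x (v @ [i]) (w @ [i])} = dom v \<inter> dom w - apart"
  proof (intro set_eqI iffI)
    fix x assume "x \<in> {x. meets x (v @ [i]) (w @ [i])}"
    then obtain e where e: "walk r (v @ [i]) x e" "walk r (w @ [i]) x e" unfolding meets_def by blast
    have "r i p q" if "walk r (v @ [i]) x p" "walk r (w @ [i]) x q" for p q
      using walk_end_unique[OF that(1) e(1)] walk_end_unique[OF e(2) that(2)] r_trans by blast
    then have "x \<notin> apart" unfolding apart_def \<S>_def by blast
    then show "x \<in> dom v \<inter> dom w - apart" using e unfolding dom_def by blast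
  next
    fix x assume x: "x \<in> dom v \<inter> dom w - apart"
    then obtain p q where pq: "walk r (v @ [i]) x p" "walk r (w @ [i]) x q" unfolding dom_def by blast
    have "r i p q"
    proof (rule ccontr)
      assume "\<not> r i p q"
      with pq obtain V W where VW: "open V" "open W" "p \<in> V" "q \<in> W"
        "\<forall>p\<in>V. \<forall>q\<in>W. \<not> r i p q"
        using r_separated[of i p q] walk_end_refl by metis
      then have "(V, W) \<in> \<S>" unfolding \<S>_def by simp
      then have "x \<in> apart" unfolding apart_def using VW(3,4) pq by (intro UN_I) auto
      then show False using x by blast
    qed
    then have "walk r (w @ [i]) x p" using walk_end_closed[OF pq(2)] r_sym by blast
    then show "x \<in> {x. meets x (v @ [i]) (w @ [i])}" using pq unfolding meets_def by blast
  qed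
  ultimately show ?thesis by simp
qed

text \<open>A further step in chart \<open>i\<close> does not leave the plaque named by
  \<open>w @ [i]\<close>. This reduces to words with a common last letter.\<close>

lemma meets_snoc_iff: "meets x v (w @ [i]) \<longleftrightarrow> meets x (v @ [i]) (w @ [i])"
proof
  assume "meets x v (w @ [i])"
  then obtain p where "walk r v x p" "walk r (w @ [i]) x p" unfolding meets_def by blast
  moreover from this have "r i p p" using walk_end_refl by blast
  ultimately show "meets x (v @ [i]) (w @ [i])" unfolding meets_def by (auto simp: walk_append)
next
  assume "meets x (v @ [i]) (w @ [i])"
  then obtain p q where "walk r v x q" "r i q p" "walk r (w @ [i]) x p"
    unfolding meets_def by (auto simp: walk_append[of r v])
  then show "meets x v (w @ [i])" using walk_end_closed r_sym unfolding meets_def by blast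
qed

lemma measurable_meets:
  assumes "w \<noteq> []"
  shows "{x. meets x v w} \<in> sets borel"
proof -
  obtain u i where "w = u @ [i]" using assms by (metis rev_exhaust)
  then show ?thesis using measurable_meets_snoc[of v i u] meets_snoc_iff[of _ v u i] by simp
qed

text \<open>Words name plaques, not points, so the ends are quantified existentially, at the cost of
  a bounded error. The second word is nonempty because the measurability of \<open>meets\<close>
  relies on its last letter.\<close>

definition near :: "'a \<Rightarrow> nat \<Rightarrow> nat list \<Rightarrow> nat list \<Rightarrow> bool" where
  "near x k v w \<longleftrightarrow> w \<noteq> [] \<and> (\<exists>p q. walk r v x p \<and> walk r w x q \<and> walk_dist r p q \<le> k)"

lemma in_orbit_of_walk:
  assumes "walk r v x p" "walk r w x q"
  shows "q \<in> orbit r p"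
proof -
  have "walk r (rev v) p x" using walk_rev[of r, OF r_sym assms(1)] .
  then have "walk r (rev v @ w) p q" using assms(2) unfolding walk_append by blast
  then show ?thesis unfolding orbit_def by blast
qed

text \<open>Appending a connecting walk \<open>u\<close> to the first word turns the distance bound
  into a countable union of conditions \<open>meets\<close>.\<close>

lemma near_iff: "near x k v w \<longleftrightarrow> w \<noteq> [] \<and> (\<exists>u. length u \<le> k \<and> meets x (v @ u) w)"
proof -
  have "(\<exists>p q. walk r v x p \<and> walk r w x q \<and> walk_dist r p q \<le> k) \<longleftrightarrow>
      (\<exists>u. length u \<le> k \<and> meets x (v @ u) w)"
  proof
    assume "\<exists>p q. walk r v x p \<and> walk r w x q \<and> walk_dist r p q \<le> k"
    then obtain p q where pq: "walk r v x p" "walk r w x q" "walk_dist r p q \<le> k" by blast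
    obtain u where "walk r u p q" "length u = walk_dist r p q"
      using shortest_walk in_orbit_of_walk[OF pq(1,2)] by metis
    then show "\<exists>u. length u \<le> k \<and> meets x (v @ u) w"
      using pq unfolding meets_def walk_append by metis
  next
    assume "\<exists>u. length u \<le> k \<and> meets x (v @ u) w"
    then obtain u p q where "length u \<le> k" "walk r v x p" "walk r u p q" "walk r w x q"
      unfolding meets_def walk_append by blast
    moreover from this have "walk_dist r p q \<le> k" using walk_dist_le[of r u p q] by simp
    ultimately show "\<exists>p q. walk r v x p \<and> walk r w x q \<and> walk_dist r p q \<le> k" by blast
  qed
  then show ?thesis unfolding near_def by simp
qed

lemma measurable_near: "{x. near x k v w} \<in> sets borel"
proof (cases "w = []")
  case False
  have "{x. near x k v w} = (\<Union>u\<in>{u. length u \<le> k}. {x. meets x (v @ u) w})"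
    using False unfolding near_iff by blast
  also have "\<dots> \<in> sets borel" using measurable_meets[OF False] by (intro sets.countable_UN') auto
  finally show ?thesis .
qed (simp add: near_def)

definition valid :: "'a \<Rightarrow> nat list \<Rightarrow> bool" where
  "valid x w \<longleftrightarrow> w \<noteq> [] \<and> (\<exists>p. walk r w x p)"

lemma measurable_valid: "{x. valid x w} \<in> sets borel"
proof -
  have "open {x. \<exists>p\<in>UNIV. walk r w x p}" by (intro open_walk) simp
  then show ?thesis unfolding valid_def by (cases "w = []") auto
qed

section \<open>Coarse correspondences between orbits in terms of words\<close>

definition words :: "nat \<Rightarrow> nat list set" where
  "words n = {w. set w \<subseteq> {..<m} \<and> length w \<le> n}"

lemma finite_words: "finite (words n)"
  unfolding words_def by (rule finite_lists_length_le) simp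

abbreviation orbit_dist :: "'a \<Rightarrow> 'a \<Rightarrow> real" where
  "orbit_dist p q \<equiv> real (walk_dist r p q)"

lemma orbit_pseudometric: "pseudometric_on (orbit r x) orbit_dist"
  using pseudometric_on_orbit[of r x, OF r_sym] .

lemma nonempty_walk:
  assumes "p \<in> orbit r x"
  obtains w where "w \<noteq> []" "walk r w x p" "length w \<le> walk_dist r x p + 1" "set w \<subseteq> {..<m}"
proof -
  obtain w where w: "walk r w x p" "length w = walk_dist r x p" using shortest_walk assms .
  \<comment> \<open>A stationary step in a chart around \<open>p\<close> makes the word nonempty
    even when \<open>p = x\<close>; hence the extra 1 in the length.\<close>
  obtain i where "r i p p" using r_cover by blast
  then have "walk r (w @ [i]) x p" using w(1) unfolding walk_append by auto
  then show ?thesis using that[of "w @ [i]"] w(2) walk_set[of "w @ [i]" x p] by simp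
qed

lemma walk_dist_ends:
  assumes "w \<noteq> []" "walk r w x p" "walk r w x q"
  shows "walk_dist r p q \<le> 1"
proof -
  obtain u i where "w = u @ [i]" using assms(1) by (metis rev_exhaust)
  then have "walk r [i] p q" using assms walk_end_unique by auto
  then show ?thesis using walk_dist_le[of r "[i]"] by simp
qed

lemma walk_mem_orbit: "walk r w x p \<Longrightarrow> p \<in> orbit r x"
  unfolding orbit_def by blast

text \<open>Changing the representative of a named plaque moves it by at most 1, and this happens at
  both words.\<close>

lemma walk_dist_ends4:
  assumes "v \<noteq> []" "walk r v x p" "walk r v x p'" "w \<noteq> []" "walk r w x q" "walk r w x q'"
  shows "walk_dist r p q \<le> walk_dist r p' q' + 2"
proof -
  have "walk_dist r p q \<le> walk_dist r p p' + walk_dist r p' q"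
    "walk_dist r p' q \<le> walk_dist r p' q' + walk_dist r q' q"
    using assms by (auto intro!: walk_dist_triangle in_orbit_of_walk)
  moreover have "walk_dist r p p' \<le> 1" "walk_dist r q' q \<le> 1"
    using assms walk_dist_ends by blast+
  ultimately show ?thesis by linarith
qed

text \<open>The relation \<open>R\<close> between words encodes a coarse correspondence between the orbits of \<open>x\<close> and
  \<open>y\<close>. The length bound on \<open>c\<close> costs nothing, because a coarse correspondence distorts the distance
  to the base point linearly; it is what makes each condition depend on finitely many elements of
  \<open>R\<close>, as the compactness argument requires.\<close>

definition half_encodes ::
    "nat \<Rightarrow> 'a \<Rightarrow> 'a \<Rightarrow> (nat list \<times> nat list) set \<Rightarrow> nat list \<times> nat list \<Rightarrow> nat list \<times> nat list \<Rightarrow> bool"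
  where
  "half_encodes N x y R s t \<longleftrightarrow>
     (s \<in> R \<longrightarrow> valid x (fst s)) \<and>
     (s \<in> R \<longrightarrow> t \<in> R \<longrightarrow>
        (\<forall>k. near x k (fst s) (fst t) \<longrightarrow> near y (N * k + N) (snd s) (snd t))) \<and>
     (valid x (fst s) \<longrightarrow> (\<exists>c\<in>words (N * length (fst s) + N). (fst s, c) \<in> R))"

text \<open>The swapped half imposes the same conditions with \<open>x\<close> and \<open>y\<close>
  exchanged. The pairs \<open>(s, t)\<close> form a countable index set of conditions, as
  \<open>measurable_ex_subset\<close> requires.\<close>

definition encodes :: "nat \<Rightarrow> 'a \<Rightarrow> 'a \<Rightarrow> (nat list \<times> nat list) set \<Rightarrow> bool" where
  "encodes N x y R \<longleftrightarrow>
     (\<forall>s t. half_encodes N x y R s t \<and> half_encodes N y x (R\<inverse>) (prod.swap s) (prod.swap t))"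

lemma half_encodes_mono:
  assumes "half_encodes N x y R s t" "N \<le> N'"
  shows "half_encodes N' x y R s t"
proof -
  have "near y (N' * k + N') v w" if "near y (N * k + N) v w" for k v w
  proof -
    have "N * k + N \<le> N' * k + N'" using assms(2) by (simp add: add_mono)
    then show ?thesis using that unfolding near_def by (meson order_trans)
  qed
  moreover have "words (N * n + N) \<subseteq> words (N' * n + N')" for n
  proof -
    have "N * n + N \<le> N' * n + N'" using assms(2) by (simp add: add_mono)
    then show ?thesis unfolding words_def by auto
  qed
  ultimately show ?thesis using assms(1) unfolding half_encodes_def by blast
qed

definition words_rel :: "'a \<Rightarrow> 'a \<Rightarrow> ('a \<times> 'a) set \<Rightarrow> (nat list \<times> nat list) set" where
  "words_rel x y S = {(v, w). v \<noteq> [] \<and> w \<noteq> [] \<and> (\<exists>(p, q)\<in>S. walk r v x p \<and> walk r w y q)}"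

lemma words_rel_converse: "words_rel y x (S\<inverse>) = (words_rel x y S)\<inverse>"
  unfolding words_rel_def by auto

lemma half_encodes_words_rel:
  assumes S: "coarse_correspondence (real N) (orbit r x) orbit_dist (orbit r y) orbit_dist S"
  shows "\<exists>N'. \<forall>s t. half_encodes N' x y (words_rel x y S) s t"
proof -
  have dom: "Domain S = orbit r x" and ran: "Range S = orbit r y"
    using S unfolding coarse_correspondence_def by blast+
  have cor: "walk_dist r p' q' \<le> N * walk_dist r p q + N"
    if "(p, p') \<in> S" "(q, q') \<in> S" for p p' q q'
  proof -
    have "real (walk_dist r p' q') \<le> real N * real (walk_dist r p q) + real N"
      using S that unfolding coarse_correspondence_def by blast
    then show ?thesis
      unfolding of_nat_mult[symmetric] of_nat_add[symmetric] of_nat_le_iff .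
  qed
  \<comment> \<open>A partner of the base point: walks from \<open>y\<close> to partners of other
    points are estimated through \<open>x1\<close>.\<close>
  obtain x1 where x1: "(x, x1) \<in> S" using dom orbit_refl[of x r] by blast
  \<comment> \<open>Changing representatives gives \<open>N * (k + 2) + N\<close>, that is
    \<open>N * k + 3 * N\<close>. The partner word has length at most
    \<open>N * length (fst s) + N + walk_dist r y x1 + 1\<close>. \<open>N'\<close> covers
    both.\<close>
  define N' where "N' = 3 * N + walk_dist r y x1 + 1"
  have "half_encodes N' x y (words_rel x y S) s t" for s t
    unfolding half_encodes_def
  proof (intro conjI impI allI)
    assume "s \<in> words_rel x y S"
    then show "valid x (fst s)" unfolding words_rel_def valid_def by auto
  next
    fix k assume st: "s \<in> words_rel x y S" "t \<in> words_rel x y S" and k: "near x k (fst s) (fst t)"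
    from st(1) obtain p p' where p: "(p, p') \<in> S" "walk r (fst s) x p" "walk r (snd s) y p'" "fst s \<noteq> []"
      unfolding words_rel_def by auto
    from st(2) obtain q q' where q: "(q, q') \<in> S" "walk r (fst t) x q" "walk r (snd t) y q'"
      "fst t \<noteq> []" "snd t \<noteq> []"
      unfolding words_rel_def by auto
    from k obtain p1 q1 where "walk r (fst s) x p1" "walk r (fst t) x q1" "walk_dist r p1 q1 \<le> k"
      unfolding near_def by blast
    then have "walk_dist r p q \<le> k + 2"
      using walk_dist_ends4[OF p(4,2) _ q(4,2), of p1 q1] by simp
    then have "N * walk_dist r p q + N \<le> N * (k + 2) + N" by (intro add_mono mult_le_mono) auto
    also have "\<dots> \<le> N' * k + N'"
      unfolding N'_def by (simp add: algebra_simps)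
    finally have "walk_dist r p' q' \<le> N' * k + N'" using cor[OF p(1) q(1)] by linarith
    then show "near y (N' * k + N') (snd s) (snd t)" using p q unfolding near_def by blast
  next
    assume "valid x (fst s)"
    then obtain p where p: "fst s \<noteq> []" "walk r (fst s) x p" unfolding valid_def by blast
    then obtain p' where p': "(p, p') \<in> S" using dom walk_mem_orbit by blast
    then obtain w where w: "w \<noteq> []" "walk r w y p'" "length w \<le> walk_dist r y p' + 1" "set w \<subseteq> {..<m}"
      using nonempty_walk ran by (metis RangeI)
    have "x1 \<in> orbit r y" "p' \<in> orbit r y" using x1 p' ran by blast+
    then have "p' \<in> orbit r x1" using orbit_eq[of r, OF r_sym] by metis
    then have "walk_dist r y p' \<le> walk_dist r y x1 + walk_dist r x1 p'"
      using walk_dist_triangle \<open>x1 \<in> orbit r y\<close> by metis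
    moreover have "walk_dist r x1 p' \<le> N * walk_dist r x p + N" using cor x1 p' by blast
    moreover have "N * walk_dist r x p \<le> N * length (fst s)" by (intro mult_le_mono walk_dist_le p) simp
    moreover have "N * length (fst s) \<le> N' * length (fst s)"
      unfolding N'_def by (intro mult_le_mono1) simp
    ultimately have "length w \<le> N' * length (fst s) + N'" using w(3) unfolding N'_def by linarith
    then have "w \<in> words (N' * length (fst s) + N')" using w(4) unfolding words_def by simp
    moreover have "(fst s, w) \<in> words_rel x y S" using p p' w unfolding words_rel_def by blast
    ultimately show "\<exists>c\<in>words (N' * length (fst s) + N'). (fst s, c) \<in> words_rel x y S" by blast
  qed
  then show ?thesis by blast
qed

text \<open>Points are related when they are ends of related words. The relation is total because
  every valid word has a partner and partners are valid.\<close>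

lemma encodes_imp_coarse_correspondence:
  assumes R: "encodes N x y R"
  shows "\<exists>N' S. coarse_correspondence (real N') (orbit r x) orbit_dist (orbit r y) orbit_dist S"
proof -
  define S where "S = {(p, q). \<exists>(v, w)\<in>R. walk r v x p \<and> walk r w y q}"
  have h1: "half_encodes N x y R (a, a') (b, b')" and h2: "half_encodes N y x (R\<inverse>) (a', a) (b', b)"
    for a a' b b'
    using R unfolding encodes_def by (metis, metis swap_simp)
  have val: "valid x v" "valid y w" if "(v, w) \<in> R" for v w
    using h1[of v w] h2[of w v] that unfolding half_encodes_def by auto
  have "Domain S = orbit r x"
  proof
    show "Domain S \<subseteq> orbit r x" unfolding S_def using walk_mem_orbit by blast
    show "orbit r x \<subseteq> Domain S"
    proof
      fix p assume "p \<in> orbit r x"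
      then obtain v where v: "v \<noteq> []" "walk r v x p" using nonempty_walk by metis
      then have "valid x v" unfolding valid_def by blast
      then obtain w where w: "(v, w) \<in> R" using h1[of v "[]" "[]" "[]"] unfolding half_encodes_def by auto
      then obtain q where "walk r w y q" using val unfolding valid_def by blast
      then show "p \<in> Domain S" using v w unfolding S_def by blast
    qed
  qed
  moreover have "Range S = orbit r y"
  proof
    show "Range S \<subseteq> orbit r y" unfolding S_def using walk_mem_orbit by blast
    show "orbit r y \<subseteq> Range S"
    proof
      fix q assume "q \<in> orbit r y"
      then obtain w where w: "w \<noteq> []" "walk r w y q" using nonempty_walk by metis
      then have "valid y w" unfolding valid_def by blast
      then obtain v where v: "(v, w) \<in> R" using h2[of w "[]" "[]" "[]"] unfolding half_encodes_def by auto
      then obtain p where "walk r v x p" using val unfolding valid_def by blast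
      then show "q \<in> Range S" using v w unfolding S_def by blast
    qed
  qed
  moreover have "orbit_dist p q \<le> real (N + 2) * orbit_dist p' q' + real (N + 2) \<and>
      orbit_dist p' q' \<le> real (N + 2) * orbit_dist p q + real (N + 2)"
    if "(p, p') \<in> S" "(q, q') \<in> S" for p p' q q'
  proof -
    from that obtain a a' b b' where ab: "(a, a') \<in> R" "(b, b') \<in> R"
      and w: "walk r a x p" "walk r a' y p'" "walk r b x q" "walk r b' y q'"
      unfolding S_def by blast
    have ne: "a \<noteq> []" "a' \<noteq> []" "b \<noteq> []" "b' \<noteq> []" using val ab unfolding valid_def by blast+
    \<comment> \<open>\<open>near\<close> controls some ends of the two words; passing to the given
      ends adds 2, which is absorbed by \<open>N + 2\<close>.\<close>
    have half: "walk_dist r q1 q2 \<le> (N + 2) * n + (N + 2)"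
      if n: "near z (N * n + N) c1 c2" and c: "c1 \<noteq> []" "c2 \<noteq> []" "walk r c1 z q1" "walk r c2 z q2"
      for z n c1 c2 q1 q2
    proof -
      obtain p1 p2 where "walk r c1 z p1" "walk r c2 z p2" "walk_dist r p1 p2 \<le> N * n + N"
        using n unfolding near_def by blast
      then have "walk_dist r q1 q2 \<le> N * n + N + 2"
        using walk_dist_ends4[OF c(1,3) _ c(2,4), of p1 p2] by simp
      then show ?thesis by (simp add: algebra_simps)
    qed
    have "near x (walk_dist r p q) a b" "near y (walk_dist r p' q') a' b'"
      using w ne unfolding near_def by blast+
    then have "near y (N * walk_dist r p q + N) a' b'" "near x (N * walk_dist r p' q' + N) a b"
      using h1[of a a' b b'] h2[of a' a b' b] ab unfolding half_encodes_def by auto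
    then have "walk_dist r p' q' \<le> (N + 2) * walk_dist r p q + (N + 2)"
      "walk_dist r p q \<le> (N + 2) * walk_dist r p' q' + (N + 2)"
      using half ne w by blast+
    then show ?thesis
      unfolding of_nat_mult[symmetric] of_nat_add[symmetric] of_nat_le_iff by blast
  qed
  ultimately have "coarse_correspondence (real (N + 2)) (orbit r x) orbit_dist (orbit r y) orbit_dist S"
    unfolding coarse_correspondence_def by blast
  then show ?thesis by blast
qed

lemma coarsely_quasi_isometric_orbits_iff:
  "coarsely_quasi_isometric (orbit r x) orbit_dist (orbit r y) orbit_dist \<longleftrightarrow>
    (\<exists>N R. encodes N x y R)"
proof -
  have "\<exists>N R. encodes N x y R"
    if S: "coarse_correspondence (real N) (orbit r x) orbit_dist (orbit r y) orbit_dist S" for N S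
  proof -
    obtain N1 where N1: "\<And>s t. half_encodes N1 x y (words_rel x y S) s t"
      using half_encodes_words_rel[OF S] by blast
    obtain N2 where N2: "\<And>s t. half_encodes N2 y x ((words_rel x y S)\<inverse>) s t"
      using half_encodes_words_rel[OF coarse_correspondence_converse[OF S]]
      unfolding words_rel_converse by blast
    \<comment> \<open>The two directions come with different constants; by monotonicity their sum
      serves both.\<close>
    have "encodes (N1 + N2) x y (words_rel x y S)"
      unfolding encodes_def by (auto intro: half_encodes_mono[OF N1] half_encodes_mono[OF N2])
    then show ?thesis by blast
  qed
  then show ?thesis
    unfolding coarsely_quasi_isometric_iff[OF orbit_pseudometric orbit_pseudometric]
    using encodes_imp_coarse_correspondence by blast
qed

section \<open>Borel measurability of the encoding conditions\<close>

lemma half_encodes_cong: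
  assumes "s \<in> R \<longleftrightarrow> s \<in> R'" "t \<in> R \<longleftrightarrow> t \<in> R'"
    and "\<And>c. c \<in> words (N * length (fst s) + N) \<Longrightarrow> (fst s, c) \<in> R \<longleftrightarrow> (fst s, c) \<in> R'"
  shows "half_encodes N x y R s t \<longleftrightarrow> half_encodes N x y R' s t"
  unfolding half_encodes_def assms(1,2) using assms(3) by (simp cong: bex_cong)

text \<open>Both positions of the variable point are required, since \<open>encodes\<close> uses the
  two orders of the base points. With \<open>R\<close>, \<open>s\<close>, \<open>t\<close> fixed,
  only countable quantifiers remain.\<close>

lemma measurable_half_encodes:
  shows "{y. half_encodes N x y R s t} \<in> sets borel" "{y. half_encodes N y x R s t} \<in> sets borel"
proof -
  have [measurable]: "Measurable.pred borel (\<lambda>y. near y k v w)" "Measurable.pred borel (\<lambda>y. valid y w)"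
    for k v w
    using measurable_near measurable_valid by (simp_all add: pred_def)
  have "Measurable.pred borel (\<lambda>y. half_encodes N x y R s t)"
    "Measurable.pred borel (\<lambda>y. half_encodes N y x R s t)"
    unfolding half_encodes_def by measurable
  then show "{y. half_encodes N x y R s t} \<in> sets borel" "{y. half_encodes N y x R s t} \<in> sets borel"
    by (simp_all add: pred_def)
qed

lemma measurable_encodes: "{y. \<exists>R. encodes N x y R} \<in> sets borel"
proof -
  define P where "P = (\<lambda>(s, t) y R.
    half_encodes N x y R s t \<and> half_encodes N y x (R\<inverse>) (prod.swap s) (prod.swap t))"
  \<comment> \<open>The pairs that condition \<open>(s, t)\<close> reads: \<open>s\<close>,
    \<open>t\<close>, the candidate partners of \<open>fst s\<close>, and, from the swapped half,
    those of \<open>snd s\<close>.\<close>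
  define F where "F = (\<lambda>(s :: nat list \<times> nat list, t :: nat list \<times> nat list).
    {s, t} \<union> {fst s} \<times> words (N * length (fst s) + N) \<union> words (N * length (snd s) + N) \<times> {snd s})"
  have "{y \<in> space borel. \<exists>R. \<forall>k. P k y R} \<in> sets borel"
  proof (rule measurable_ex_subset)
    show "finite (F k)" for k unfolding F_def by (auto simp: finite_words split: prod.split)
    fix k :: "(nat list \<times> nat list) \<times> nat list \<times> nat list" and y R
    obtain s t where k: "k = (s, t)" by (cases k)
    have "half_encodes N x y R s t \<longleftrightarrow> half_encodes N x y (R \<inter> F k) s t"
      by (rule half_encodes_cong) (simp_all add: F_def k)
    moreover have "half_encodes N y x (R\<inverse>) (prod.swap s) (prod.swap t) \<longleftrightarrow>
        half_encodes N y x ((R \<inter> F k)\<inverse>) (prod.swap s) (prod.swap t)"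
      by (rule half_encodes_cong) (simp_all add: F_def k prod.swap_def)
    ultimately show "P k y R = P k y (R \<inter> F k)" unfolding P_def k by simp
  next
    have "{y. half_encodes N x y R s t} \<inter> {y. half_encodes N y x (R\<inverse>) (prod.swap s) (prod.swap t)}
        \<in> sets borel" for R s t
      by (intro sets.Int measurable_half_encodes)
    then show "{y \<in> space borel. P k y R} \<in> sets borel" for k R
      unfolding P_def by (cases k) (simp add: Collect_conj_eq del: swap_simp)
  qed
  moreover have "(\<exists>R. \<forall>k. P k y R) \<longleftrightarrow> (\<exists>R. encodes N x y R)" for y
    unfolding P_def encodes_def by simp
  ultimately show ?thesis by simp
qed

lemma measurable_coarse_type:
  "{y. coarsely_quasi_isometric (orbit r x) orbit_dist (orbit r y) orbit_dist} \<in> sets borel"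
proof -
  have "(\<Union>N. {y. \<exists>R. encodes N x y R}) \<in> sets borel" using measurable_encodes by blast
  moreover have "(\<Union>N. {y. \<exists>R. encodes N x y R}) =
      {y. coarsely_quasi_isometric (orbit r x) orbit_dist (orbit r y) orbit_dist}"
    unfolding coarsely_quasi_isometric_orbits_iff by blast
  ultimately show ?thesis by simp
qed

end

subsection \<open>Chains of sets\<close>

text \<open>A set seen as a step relation, so that chains of successively intersecting sets are
  walks.\<close>

definition both_in :: "'a set \<Rightarrow> 'a \<Rightarrow> 'a \<Rightarrow> bool" where
  "both_in P x y \<longleftrightarrow> x \<in> P \<and> y \<in> P"

text \<open>Members of \<open>\<P>\<close> that meet the set \<open>A\<close> reachable by chains
  lie inside it. So \<open>V\<close> and \<open>W\<close> are disjoint open sets covering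
  \<open>S\<close>; as \<open>x\<close> is in \<open>V\<close>, connectedness keeps \<open>S\<close>
  away from \<open>W\<close>.\<close>

lemma chain_in_connected:
  assumes op: "\<And>P. P \<in> \<P> \<Longrightarrow> openin T P" and S: "connectedin T S" "S \<subseteq> \<Union>\<P>"
    and xy: "x \<in> S" "y \<in> S"
  shows "\<exists>Ps. set Ps \<subseteq> \<P> \<and> walk both_in Ps x y"
proof -
  define A where "A = {z. \<exists>Ps. set Ps \<subseteq> \<P> \<and> walk both_in Ps x z}"
  have sub: "P \<subseteq> A" if P: "P \<in> \<P>" "P \<inter> A \<noteq> {}" for P
  proof
    fix z assume z: "z \<in> P"
    obtain u Ps where u: "u \<in> P" "set Ps \<subseteq> \<P>" "walk both_in Ps x u" using P unfolding A_def by blast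
    then have "walk both_in (Ps @ [P]) x z" using z unfolding walk_append by (auto simp: both_in_def)
    then show "z \<in> A" unfolding A_def using u P(1) by (intro CollectI exI[of _ "Ps @ [P]"]) auto
  qed
  define V where "V = \<Union>{P \<in> \<P>. P \<inter> A \<noteq> {}}"
  define W where "W = \<Union>{P \<in> \<P>. P \<inter> A = {}}"
  have "x \<in> A" unfolding A_def by (intro CollectI exI[of _ "[]"]) simp
  have "openin T V" "openin T W" unfolding V_def W_def using op by (auto intro!: openin_Union)
  moreover have SVW: "S \<subseteq> V \<union> W"
  proof
    fix u assume "u \<in> S"
    then obtain P where "P \<in> \<P>" "u \<in> P" using S(2) by blast
    then show "u \<in> V \<union> W" unfolding V_def W_def by (cases "P \<inter> A = {}") auto
  qed
  moreover have VA: "V \<subseteq> A" and "W \<inter> A = {}" unfolding V_def W_def using sub by blast+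
  moreover have "x \<in> V" unfolding V_def using \<open>x \<in> A\<close> xy S(2) by blast
  ultimately have "S \<inter> W = {}" using connectedinD[OF S(1), of V W] xy(1) by blast
  then have "y \<in> A" using SVW VA xy by blast
  then show ?thesis unfolding A_def by blast
qed

text \<open>Cutting out the part between two visits to the same set. This compares lengths of chains
  with cardinalities of sets of plaques.\<close>

lemma distinct_chain:
  assumes "set Ps \<subseteq> \<P>" "walk both_in Ps x y"
  shows "\<exists>Qs. distinct Qs \<and> set Qs \<subseteq> \<P> \<and> walk both_in Qs x y"
  using assms
proof (induction "length Ps" arbitrary: Ps rule: less_induct)
  case less
  show ?case
  proof (cases "distinct Ps")
    case False
    then obtain us vs ws P where Ps: "Ps = us @ [P] @ vs @ [P] @ ws"
      using not_distinct_decomp by blast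
    then have "walk both_in (us @ [P] @ ws) x y"
      using less.prems(2) unfolding Ps walk_append by (auto simp: both_in_def)
    moreover have "set (us @ [P] @ ws) \<subseteq> \<P>" "length (us @ [P] @ ws) < length Ps"
      using less.prems(1) Ps by auto
    ultimately show ?thesis using less.hyps by blast
  qed (use less.prems in blast)
qed

lemma connectedin_chain:
  assumes "\<And>P. P \<in> set Ps \<Longrightarrow> connectedin T P" "walk both_in Ps x y" "Ps \<noteq> []"
  shows "connectedin T (\<Union>(set Ps)) \<and> x \<in> \<Union>(set Ps) \<and> y \<in> \<Union>(set Ps)"
  using assms
proof (induction Ps arbitrary: x)
  case (Cons P Ps)
  from Cons.prems(2) obtain z where z: "x \<in> P" "z \<in> P" "walk both_in Ps z y"
    unfolding walk.simps both_in_def by blast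
  show ?case
  proof (cases "Ps = []")
    case True
    then show ?thesis using z Cons.prems by auto
  next
    case False
    then have IH: "connectedin T (\<Union>(set Ps))" "z \<in> \<Union>(set Ps)" "y \<in> \<Union>(set Ps)"
      using Cons.IH[OF _ z(3)] Cons.prems(1) by auto
    have "connectedin T (P \<union> \<Union>(set Ps))"
      using Cons.prems(1) IH z by (intro connectedin_Un) auto
    then show ?thesis using z IH by simp
  qed
qed simp

lemma walk_transfer:
  assumes "\<And>i x y. i \<in> I \<Longrightarrow> r i x y \<Longrightarrow> \<exists>j\<in>J. s j x y"
  shows "set w \<subseteq> I \<Longrightarrow> walk r w x y \<Longrightarrow> \<exists>v. length v = length w \<and> set v \<subseteq> J \<and> walk s v x y"
proof (induction w arbitrary: x)
  case (Cons i w)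
  from Cons.prems(2) obtain z where z: "r i x z" "walk r w z y" by auto
  have "set w \<subseteq> I" "i \<in> I" using Cons.prems(1) by auto
  then obtain v j where "length v = length w" "set v \<subseteq> J" "walk s v z y" "j \<in> J" "s j x z"
    using Cons.IH[OF _ z(2)] assms[OF _ z(1)] by blast
  then show ?case by (intro exI[of _ "j # v"]) auto
qed simp

subsection \<open>Plaques and leaves\<close>

definition same_plaque :: "('a, 'n::finite, 'z) fchart \<Rightarrow> 'a \<Rightarrow> 'a \<Rightarrow> bool" where
  "same_plaque C x y \<longleftrightarrow> x \<in> fdom C \<and> y \<in> fdom C \<and> snd (fmap C x) = snd (fmap C y)"

lemma chart_homeomorphic:
  "is_chart C \<Longrightarrow> homeomorphic_map (top_of_set (fdom C))
    (prod_topology (top_of_set (fball C)) (ftrans C)) (fmap C)"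
  unfolding is_chart_def by blast

lemma open_fdom: "is_chart C \<Longrightarrow> open (fdom C)"
  unfolding is_chart_def by blast

lemma fmap_image: "is_chart C \<Longrightarrow> fmap C ` fdom C = fball C \<times> topspace (ftrans C)"
  using homeomorphic_imp_surjective_map[OF chart_homeomorphic] by fastforce

lemma snd_fmap_mem: "is_chart C \<Longrightarrow> x \<in> fdom C \<Longrightarrow> snd (fmap C x) \<in> topspace (ftrans C)"
  using fmap_image by (metis imageI mem_Times_iff)

lemma openin_fmap_image:
  assumes C: "is_chart C" and "open V"
  shows "openin (prod_topology (top_of_set (fball C)) (ftrans C)) (fmap C ` (V \<inter> fdom C))"
proof -
  have "openin (top_of_set (fdom C)) (V \<inter> fdom C)" using assms(2) by (auto simp: openin_open)
  then show ?thesis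
    using homeomorphic_imp_open_map[OF chart_homeomorphic[OF C]] unfolding open_map_def by blast
qed

lemma open_transversal_preimage:
  assumes C: "is_chart C" and W: "openin (ftrans C) W"
  shows "open {x \<in> fdom C. snd (fmap C x) \<in> W}"
proof -
  have "continuous_map (top_of_set (fdom C)) (ftrans C) (snd \<circ> fmap C)"
    by (rule continuous_map_compose[OF homeomorphic_imp_continuous_map[OF chart_homeomorphic[OF C]]
      continuous_map_snd])
  then have "openin (top_of_set (fdom C)) {x \<in> fdom C. snd (fmap C x) \<in> W}"
    using openin_continuous_map_preimage[OF _ W] by fastforce
  then show ?thesis using open_fdom[OF C] openin_open_trans by blast
qed

text \<open>The projection of a product to its second factor is open, so the plaques that meet
  \<open>V\<close> correspond to an open subset of the transversal, which is pulled back.\<close>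

lemma open_same_plaque:
  assumes C: "is_chart C" and V: "open V"
  shows "open {x. \<exists>y\<in>V. same_plaque C x y}"
proof -
  have "openin (ftrans C) (snd ` fmap C ` (V \<inter> fdom C))"
    using open_map_snd openin_fmap_image[OF C V] unfolding open_map_def by blast
  moreover have "{x. \<exists>y\<in>V. same_plaque C x y} =
      {x \<in> fdom C. snd (fmap C x) \<in> snd ` fmap C ` (V \<inter> fdom C)}"
    unfolding same_plaque_def by force
  ultimately show ?thesis using open_transversal_preimage[OF C] by simp
qed

lemma separated_same_plaque:
  assumes C: "is_chart C" and pq: "p \<in> fdom C" "q \<in> fdom C" "\<not> same_plaque C p q"
  shows "\<exists>V W. open V \<and> open W \<and> p \<in> V \<and> q \<in> W \<and> (\<forall>p'\<in>V. \<forall>q'\<in>W. \<not> same_plaque C p' q')"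
proof -
  have "Hausdorff_space (ftrans C)"
    using C completely_metrizable_imp_metrizable_space metrizable_imp_Hausdorff_space
    unfolding is_chart_def by blast
  then obtain A B where AB: "openin (ftrans C) A" "openin (ftrans C) B"
      "snd (fmap C p) \<in> A" "snd (fmap C q) \<in> B" "disjnt A B"
    using snd_fmap_mem[OF C] pq unfolding Hausdorff_space_def same_plaque_def by metis
  show ?thesis
    using open_transversal_preimage[OF C AB(1)] open_transversal_preimage[OF C AB(2)] AB(3-5) pq(1,2)
    by (intro exI[of _ "{x \<in> fdom C. snd (fmap C x) \<in> A}"] exI[of _ "{x \<in> fdom C. snd (fmap C x) \<in> B}"])
      (auto simp: same_plaque_def disjnt_iff)
qed

text \<open>Charts of \<open>\<F>\<close> are by definition compatible with the charts of a
  generating atlas; two of them are compared through a chart \<open>E\<close> of that atlas around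
  \<open>p\<close>.\<close>

lemma transverse_change:
  assumes F: "foliated_structure \<F>" and CD: "C \<in> \<F>" "D \<in> \<F>" and p: "p \<in> fdom C" "p \<in> fdom D"
  shows "\<exists>W h. open W \<and> p \<in> W \<and> W \<subseteq> fdom C \<inter> fdom D \<and>
    (\<forall>q\<in>W. snd (fmap D q) = h (snd (fmap C q)))"
proof -
  obtain \<A> where A: "foliated_atlas \<A>" "\<F> = foliated_charts \<A>"
    using F unfolding foliated_structure_def by blast
  obtain E where E: "E \<in> \<A>" "p \<in> fdom E" using A(1) unfolding foliated_atlas_def by blast
  have "compatible C E" "compatible E D" using A(2) CD E(1) unfolding foliated_charts_def by blast+
  then obtain W1 f1 h1 W2 f2 h2 where
    1: "open W1" "p \<in> W1" "W1 \<subseteq> fdom C \<inter> fdom E"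
      "\<forall>q\<in>W1. fmap E q = (f1 (fmap C q), h1 (snd (fmap C q)))" and
    2: "open W2" "p \<in> W2" "W2 \<subseteq> fdom E \<inter> fdom D"
      "\<forall>q\<in>W2. fmap D q = (f2 (fmap E q), h2 (snd (fmap E q)))"
    using p E(2) unfolding compatible_def by (metis IntI)
  then show ?thesis
    by (intro exI[of _ "W1 \<inter> W2"] exI[of _ "h2 \<circ> h1"]) auto
qed

lemma foliated_structure_is_chart: "foliated_structure \<F> \<Longrightarrow> C \<in> \<F> \<Longrightarrow> is_chart C"
  unfolding foliated_structure_def foliated_charts_def by blast

lemma openin_plaque: "C \<in> \<F> \<Longrightarrow> P \<in> plaques C \<Longrightarrow> openin (leaf_topology \<F>) P"
  unfolding leaf_topology_def by (rule topology_generated_by_Basis) blast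

lemma plaque_eq_image:
  assumes C: "is_chart C" and z: "z \<in> topspace (ftrans C)"
  shows "plaque C z = (\<lambda>x. chart_inv C (x, z)) ` fball C"
proof -
  have inv: "chart_inv C (x, z) \<in> fdom C" "fmap C (chart_inv C (x, z)) = (x, z)" if "x \<in> fball C" for x
  proof -
    have "(x, z) \<in> fmap C ` fdom C" using fmap_image[OF C] z that by blast
    then show "chart_inv C (x, z) \<in> fdom C" "fmap C (chart_inv C (x, z)) = (x, z)"
      unfolding chart_inv_def by (rule inv_into_into, rule f_inv_into_f)
  qed
  have inj: "inj_on (fmap C) (fdom C)"
    using homeomorphic_imp_injective_map[OF chart_homeomorphic[OF C]] by simp
  show ?thesis
  proof
    show "plaque C z \<subseteq> (\<lambda>x. chart_inv C (x, z)) ` fball C"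
    proof
      fix p assume p: "p \<in> plaque C z"
      then have "fmap C p \<in> fball C \<times> topspace (ftrans C)"
        using fmap_image[OF C] unfolding plaque_def by blast
      moreover have "p = chart_inv C (fst (fmap C p), z)"
        using p inj unfolding plaque_def chart_inv_def by auto
      ultimately show "p \<in> (\<lambda>x. chart_inv C (x, z)) ` fball C" by (auto simp: mem_Times_iff)
    qed
  qed (auto simp: plaque_def inv)
qed

text \<open>The inverse chart maps the ball continuously onto the plaque, even for the leaf
  topology: it suffices to test plaques of other charts, whose transverse coordinate is locally a
  function of that of \<open>C\<close>, constant along the slice.\<close>

lemma connectedin_plaque:
  assumes F: "foliated_structure \<F>" and C: "C \<in> \<F>" and P: "P \<in> plaques C"
  shows "connectedin (leaf_topology \<F>) P"
proof -
  have ch: "is_chart C" using foliated_structure_is_chart F C .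
  obtain z where z: "z \<in> topspace (ftrans C)" "P = plaque C z" using P unfolding plaques_def by blast
  define g where "g x = chart_inv C (x, z)" for x
  have im: "P = g ` fball C" using plaque_eq_image[OF ch z(1)] z(2) unfolding g_def by simp
  have g: "g x \<in> fdom C" "snd (fmap C (g x)) = z" if "x \<in> fball C" for x
    using im z(2) that unfolding plaque_def by auto
  \<comment> \<open>Continuity of \<open>g\<close> for the original topology of the space, tested on
    open sets inside the chart.\<close>
  have pre: "openin (top_of_set (fball C)) {x \<in> fball C. g x \<in> W}" if W: "open W" "W \<subseteq> fdom C" for W
  proof -
    have "continuous_map (top_of_set (fball C)) (prod_topology (top_of_set (fball C)) (ftrans C)) (\<lambda>x. (x, z))"
      using z(1) by (intro continuous_map_pairedI) auto
    from openin_continuous_map_preimage[OF this openin_fmap_image[OF ch W(1)]]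
    have "openin (top_of_set (fball C)) {x \<in> fball C. (x, z) \<in> fmap C ` (W \<inter> fdom C)}" by simp
    moreover have "(x, z) \<in> fmap C ` (W \<inter> fdom C) \<longleftrightarrow> g x \<in> W" if x: "x \<in> fball C" for x
    proof -
      have "(x, z) \<in> fmap C ` fdom C" using fmap_image[OF ch] z x by blast
      then have gx: "fmap C (g x) = (x, z)" unfolding g_def chart_inv_def by (rule f_inv_into_f)
      have "inj_on (fmap C) (fdom C)"
        using homeomorphic_imp_injective_map[OF chart_homeomorphic[OF ch]] by simp
      then have "fmap C (g x) \<in> fmap C ` W \<longleftrightarrow> g x \<in> W"
        using g(1)[OF x] W(2) by (intro inj_on_image_mem_iff)
      then show ?thesis using gx W(2) by (simp add: Int_absorb2)
    qed
    ultimately show ?thesis by (metis (no_types, lifting) Collect_cong)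
  qed
  have "continuous_map (top_of_set (fball C)) (leaf_topology \<F>) g"
    unfolding leaf_topology_def continuous_on_generated_topo_iff
  proof (intro conjI allI impI)
    fix Q assume "Q \<in> (\<Union>C\<in>\<F>. plaques C)"
    then obtain D z' where D: "D \<in> \<F>" "Q = plaque D z'" unfolding plaques_def by blast
    show "openin (top_of_set (fball C)) (g -` Q \<inter> topspace (top_of_set (fball C)))"
    proof (subst openin_subopen, intro ballI)
      fix x assume "x \<in> g -` Q \<inter> topspace (top_of_set (fball C))"
      then have x: "x \<in> fball C" "g x \<in> plaque D z'" using D by auto
      then have "g x \<in> fdom D" unfolding plaque_def by simp
      from transverse_change[OF F C D(1) g(1)[OF x(1)] this]
      obtain W h where W: "open W" "g x \<in> W" "W \<subseteq> fdom C \<inter> fdom D"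
          "\<forall>q\<in>W. snd (fmap D q) = h (snd (fmap C q))"
        by (elim exE conjE)
      have "h z = z'" using W(2,4) x g(2) unfolding plaque_def by auto
      then have "{y \<in> fball C. g y \<in> W} \<subseteq> g -` Q \<inter> topspace (top_of_set (fball C))"
        using W(3,4) g(2) D(2) unfolding plaque_def by auto
      then show "\<exists>T. openin (top_of_set (fball C)) T \<and> x \<in> T \<and>
          T \<subseteq> g -` Q \<inter> topspace (top_of_set (fball C))"
        using pre[OF W(1)] W(2,3) x(1) by blast
    qed
  next
    show "g ` topspace (top_of_set (fball C)) \<subseteq> \<Union> (\<Union>C\<in>\<F>. plaques C)"
      using im P C by auto
  qed
  moreover have "connectedin (top_of_set (fball C)) (fball C)"
    using ch unfolding is_chart_def by (auto simp: connectedin_subtopology)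
  ultimately show ?thesis unfolding im by (rule connectedin_continuous_map_image)
qed

lemma same_plaque_mem_plaque:
  assumes "is_chart C" "same_plaque C x y"
  shows "plaque C (snd (fmap C x)) \<in> plaques C" "both_in (plaque C (snd (fmap C x))) x y"
  using assms snd_fmap_mem unfolding plaques_def plaque_def both_in_def same_plaque_def by auto

text \<open>Local finiteness and compactness. Charts with empty domain are excluded, since local
  finiteness does not bound their number.\<close>

lemma finite_nonempty_charts:
  assumes X: "compact (UNIV :: 'a::topological_space set)"
    and U: "regular_atlas \<F> (\<U> :: ('a, 'n::finite, 'z) fchart set)"
  shows "finite {C \<in> \<U>. fdom C \<noteq> {}}"
proof -
  have "\<forall>x. \<exists>V. open V \<and> x \<in> V \<and> finite {C \<in> \<U>. fdom C \<inter> V \<noteq> {}}"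
    using U unfolding regular_atlas_def by blast
  from choice[OF this] obtain V where
    V: "\<And>x. open (V x)" "\<And>x. x \<in> V x" "\<And>x. finite {C \<in> \<U>. fdom C \<inter> V x \<noteq> {}}"
    by blast
  have "UNIV \<subseteq> (\<Union>x. V x)" using V(2) by blast
  then obtain S where S: "finite S" "(UNIV :: 'a set) \<subseteq> (\<Union>x\<in>S. V x)"
    using compactE_image[OF X, of UNIV V] V(1) by metis
  have "{C \<in> \<U>. fdom C \<noteq> {}} \<subseteq> (\<Union>x\<in>S. {C \<in> \<U>. fdom C \<inter> V x \<noteq> {}})"
  proof
    fix C assume C: "C \<in> {C \<in> \<U>. fdom C \<noteq> {}}"
    then obtain p where "p \<in> fdom C" by blast
    moreover from S(2) obtain x where "x \<in> S" "p \<in> V x" by blast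
    ultimately show "C \<in> (\<Union>x\<in>S. {C \<in> \<U>. fdom C \<inter> V x \<noteq> {}})" using C by blast
  qed
  then show ?thesis using S(1) V(3) by (meson finite_UN_I finite_subset)
qed

text \<open>Numbering the charts makes words lists of natural numbers, hence countable in
  number.\<close>

definition plaque_rel :: "('a, 'n::finite, 'z) fchart list \<Rightarrow> nat \<Rightarrow> 'a \<Rightarrow> 'a \<Rightarrow> bool" where
  "plaque_rel Cs i x y \<longleftrightarrow> i < length Cs \<and> same_plaque (Cs ! i) x y"

locale regular_foliation =
  fixes \<F> \<U> :: "('a::topological_space, 'n::finite, 'z) fchart set"
    and Cs :: "('a, 'n, 'z) fchart list"
  assumes foliated: "foliated_structure \<F>" and regular: "regular_atlas \<F> \<U>"
    and set_Cs: "set Cs = {C \<in> \<U>. fdom C \<noteq> {}}"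
begin

lemma atlas_subset: "\<U> \<subseteq> \<F>"
  using regular unfolding regular_atlas_def by (elim conjE)

lemma atlas_is_chart: "C \<in> \<U> \<Longrightarrow> is_chart C"
  using foliated_structure_is_chart[OF foliated] atlas_subset by blast

lemma nth_Cs_mem: "i < length Cs \<Longrightarrow> Cs ! i \<in> \<U>"
  using set_Cs nth_mem by fast

lemma chart_index:
  assumes "C \<in> \<U>" "x \<in> fdom C"
  obtains i where "i < length Cs" "Cs ! i = C"
  using assms set_Cs by (metis (mono_tags, lifting) empty_iff in_set_conv_nth mem_Collect_eq)

lemma atlas_cover:
  obtains C where "C \<in> \<U>" "x \<in> fdom C"
proof -
  have "(\<Union>C\<in>\<U>. fdom C) = UNIV" using regular unfolding regular_atlas_def by (elim conjE)
  then show ?thesis using that by blast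
qed

text \<open>\<open>?P\<close> meets both \<open>?Q\<close> and \<open>?Q'\<close>, so regularity
  makes these two plaques equal.\<close>

lemma same_plaque_holonomy:
  assumes CD: "C \<in> \<U>" "D \<in> \<U>" and "same_plaque C p q" "same_plaque D p p'" "same_plaque D q q'"
  shows "same_plaque D p' q'"
proof -
  let ?P = "plaque C (snd (fmap C p))"
  let ?Q = "plaque D (snd (fmap D p))"
  let ?Q' = "plaque D (snd (fmap D q))"
  have "?P \<in> plaques C" "?Q \<in> plaques D" "?Q' \<in> plaques D"
    using same_plaque_mem_plaque(1) CD assms atlas_is_chart by blast+
  moreover have "p \<in> ?P" "q \<in> ?P" "p \<in> ?Q" "q \<in> ?Q'"
    using assms unfolding plaque_def same_plaque_def by auto
  then have "closure ?P \<inter> closure ?Q \<noteq> {}" "closure ?P \<inter> closure ?Q' \<noteq> {}"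
    using closure_subset by blast+
  moreover have "\<forall>C\<in>\<U>. \<forall>D\<in>\<U>. \<forall>P\<in>plaques C. \<forall>Q\<in>plaques D. \<forall>Q'\<in>plaques D.
      closure P \<inter> closure Q \<noteq> {} \<longrightarrow> closure P \<inter> closure Q' \<noteq> {} \<longrightarrow> Q = Q'"
    using regular unfolding regular_atlas_def by (elim conjE)
  ultimately have "?Q = ?Q'" using CD by meson
  then have "snd (fmap D q) = snd (fmap D p)" using \<open>q \<in> ?Q'\<close> unfolding plaque_def by auto
  then show ?thesis using assms unfolding same_plaque_def by simp
qed

sublocale plaque_relations "plaque_rel Cs" "length Cs"
proof
  show "\<exists>i. plaque_rel Cs i x x" for x
  proof -
    obtain C where C: "C \<in> \<U>" "x \<in> fdom C" using atlas_cover .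
    then obtain i where "i < length Cs" "Cs ! i = C" using chart_index by blast
    then show ?thesis using C unfolding plaque_rel_def same_plaque_def by auto
  qed
  show "open {x. \<exists>y\<in>V. plaque_rel Cs i x y}" if "open V" for V i
    using open_same_plaque[OF atlas_is_chart[OF nth_Cs_mem] that]
    by (cases "i < length Cs") (auto simp: plaque_rel_def)
  show "plaque_rel Cs j p' q'"
    if "plaque_rel Cs i p q" "plaque_rel Cs j p p'" "plaque_rel Cs j q q'" for i j p q p' q'
    using that same_plaque_holonomy nth_Cs_mem unfolding plaque_rel_def by blast
  show "\<exists>V W. open V \<and> open W \<and> p \<in> V \<and> q \<in> W \<and> (\<forall>p'\<in>V. \<forall>q'\<in>W. \<not> plaque_rel Cs i p' q')"
    if "plaque_rel Cs i p p" "plaque_rel Cs i q q" "\<not> plaque_rel Cs i p q" for i p q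
  proof -
    have i: "i < length Cs" and "p \<in> fdom (Cs ! i)" "q \<in> fdom (Cs ! i)" "\<not> same_plaque (Cs ! i) p q"
      using that unfolding plaque_rel_def same_plaque_def by auto
    from separated_same_plaque[OF atlas_is_chart[OF nth_Cs_mem[OF i]] this(2-)]
    show ?thesis using i unfolding plaque_rel_def by auto
  qed
qed (auto simp: plaque_rel_def same_plaque_def)

section \<open>Leaves and leaf metrics in terms of words\<close>

abbreviation atlas_plaques :: "'a set set" where
  "atlas_plaques \<equiv> (\<Union>C\<in>\<U>. plaques C)"

text \<open>A chart together with a point of its domain determines a plaque, so chains and words
  translate letter by letter. Equality of lengths is what the comparison of metrics uses.\<close>

lemma chain_iff_walk:
  "(\<exists>Ps. length Ps = n \<and> set Ps \<subseteq> atlas_plaques \<and> walk both_in Ps x y) \<longleftrightarrow>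
    (\<exists>w. length w = n \<and> walk (plaque_rel Cs) w x y)"
proof
  assume "\<exists>Ps. length Ps = n \<and> set Ps \<subseteq> atlas_plaques \<and> walk both_in Ps x y"
  then obtain Ps where Ps: "length Ps = n" "set Ps \<subseteq> atlas_plaques" "walk both_in Ps x y" by blast
  have step: "\<exists>i\<in>UNIV. plaque_rel Cs i u v" if Puv: "P \<in> atlas_plaques" "both_in P u v" for P u v
  proof -
    obtain C where C: "C \<in> \<U>" "same_plaque C u v"
      using Puv unfolding plaques_def plaque_def both_in_def same_plaque_def by auto
    then obtain i where "i < length Cs" "Cs ! i = C"
      using chart_index[of C u] unfolding same_plaque_def by blast
    then show ?thesis using C unfolding plaque_rel_def by auto
  qed
  have "\<exists>w. length w = length Ps \<and> set w \<subseteq> UNIV \<and> walk (plaque_rel Cs) w x y"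
    by (rule walk_transfer[OF _ Ps(2,3)]) (rule step)
  then show "\<exists>w. length w = n \<and> walk (plaque_rel Cs) w x y" using Ps(1) by simp
next
  assume "\<exists>w. length w = n \<and> walk (plaque_rel Cs) w x y"
  then obtain w where w: "length w = n" "walk (plaque_rel Cs) w x y" by blast
  have step: "\<exists>P\<in>atlas_plaques. both_in P u v" if uv: "plaque_rel Cs i u v" for i u v
  proof -
    have i: "Cs ! i \<in> \<U>" and "same_plaque (Cs ! i) u v"
      using uv nth_Cs_mem unfolding plaque_rel_def by auto
    from same_plaque_mem_plaque[OF atlas_is_chart[OF i] this(2)] show ?thesis using i by blast
  qed
  have "\<exists>Ps. length Ps = length w \<and> set Ps \<subseteq> atlas_plaques \<and> walk both_in Ps x y"
    by (rule walk_transfer[OF _ subset_UNIV w(2)]) (rule step)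
  then show "\<exists>Ps. length Ps = n \<and> set Ps \<subseteq> atlas_plaques \<and> walk both_in Ps x y" using w(1) by simp
qed

lemma openin_atlas_plaque: "P \<in> atlas_plaques \<Longrightarrow> openin (leaf_topology \<F>) P"
  using openin_plaque atlas_subset by blast

lemma connectedin_atlas_plaque: "P \<in> atlas_plaques \<Longrightarrow> connectedin (leaf_topology \<F>) P"
  using connectedin_plaque[OF foliated] atlas_subset by blast

lemma Union_atlas_plaques: "\<Union>atlas_plaques = UNIV"
proof -
  have "x \<in> \<Union>atlas_plaques" for x
  proof -
    obtain C where C: "C \<in> \<U>" "x \<in> fdom C" using atlas_cover .
    then have "same_plaque C x x" unfolding same_plaque_def by simp
    then show ?thesis
      using same_plaque_mem_plaque[OF atlas_is_chart[OF C(1)]] C(1) unfolding both_in_def by blast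
  qed
  then show ?thesis by blast
qed

lemma topspace_leaf_topology: "topspace (leaf_topology \<F>) = UNIV"
proof -
  have "\<Union>atlas_plaques \<subseteq> topspace (leaf_topology \<F>)"
    by (rule Union_least) (rule openin_subset[OF openin_atlas_plaque])
  then show ?thesis unfolding Union_atlas_plaques by blast
qed

text \<open>The plaques of the atlas form a cover by sets open and connected in the leaf topology,
  so its components are the sets reachable by chains.\<close>

lemma leaf_eq_orbit: "leaf \<F> x = orbit (plaque_rel Cs) x"
proof
  show "leaf \<F> x \<subseteq> orbit (plaque_rel Cs) x"
  proof
    fix y assume "y \<in> leaf \<F> x"
    then obtain S where S: "connectedin (leaf_topology \<F>) S" "x \<in> S" "y \<in> S"
      unfolding leaf_def connected_component_of_def by blast
    have "S \<subseteq> \<Union>atlas_plaques" unfolding Union_atlas_plaques by (rule subset_UNIV)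
    with S have "\<exists>Ps. set Ps \<subseteq> atlas_plaques \<and> walk both_in Ps x y"
      by (intro chain_in_connected[of atlas_plaques "leaf_topology \<F>" S]) (rule openin_atlas_plaque)
    then obtain Ps where "set Ps \<subseteq> atlas_plaques" "walk both_in Ps x y" by (elim exE conjE)
    then obtain w where "walk (plaque_rel Cs) w x y"
      using chain_iff_walk[of "length Ps" x y] by blast
    then show "y \<in> orbit (plaque_rel Cs) x" by (rule walk_mem_orbit)
  qed
  show "orbit (plaque_rel Cs) x \<subseteq> leaf \<F> x"
  proof
    fix y assume "y \<in> orbit (plaque_rel Cs) x"
    \<comment> \<open>The word must be nonempty, since the union of an empty chain contains no
      point.\<close>
    then obtain w where w: "w \<noteq> []" "walk (plaque_rel Cs) w x y" by (rule nonempty_walk)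
    then obtain Ps where Ps: "length Ps = length w" "set Ps \<subseteq> atlas_plaques" "walk both_in Ps x y"
      using chain_iff_walk[of "length w" x y] by blast
    have "connectedin (leaf_topology \<F>) (\<Union>(set Ps)) \<and> x \<in> \<Union>(set Ps) \<and> y \<in> \<Union>(set Ps)"
      using Ps w(1) by (intro connectedin_chain connectedin_atlas_plaque) auto
    then show "y \<in> leaf \<F> x" unfolding leaf_def connected_component_of_def by blast
  qed
qed

text \<open>A set of plaques with connected union contains a chain without repetitions from
  \<open>x\<close> to \<open>y\<close>; conversely a nonempty chain has connected union.\<close>

lemma plaque_dist_eq:
  assumes y: "y \<in> orbit (plaque_rel Cs) x"
  shows "plaque_dist \<F> \<U> x y = orbit_dist x y"
proof (cases "x = y")
  case True
  then show ?thesis unfolding plaque_dist_def by (simp add: walk_dist_refl)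
next
  case False
  define Q where "Q k \<P> \<longleftrightarrow> \<P> \<subseteq> atlas_plaques \<and> finite \<P> \<and> card \<P> = k \<and>
    connectedin (leaf_topology \<F>) (\<Union>\<P>) \<and> x \<in> \<Union>\<P> \<and> y \<in> \<Union>\<P>" for k \<P>
  let ?n = "walk_dist (plaque_rel Cs) x y"
  have lower: "?n \<le> k" if "Q k \<P>" for k \<P>
  proof -
    have \<P>: "\<P> \<subseteq> atlas_plaques" "finite \<P>" "card \<P> = k"
      "connectedin (leaf_topology \<F>) (\<Union>\<P>)" "x \<in> \<Union>\<P>" "y \<in> \<Union>\<P>"
      using that unfolding Q_def by blast+
    have "openin (leaf_topology \<F>) P" if "P \<in> \<P>" for P using \<P>(1) that openin_atlas_plaque by blast
    then obtain Ps where "set Ps \<subseteq> \<P>" "walk both_in Ps x y"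
      using chain_in_connected[of \<P> "leaf_topology \<F>" "\<Union>\<P>" x y] \<P> by blast
    from distinct_chain[OF this]
    obtain Qs where Qs: "distinct Qs" "set Qs \<subseteq> \<P>" "walk both_in Qs x y"
      by (elim exE conjE)
    have "set Qs \<subseteq> atlas_plaques" using Qs(2) \<P>(1) by (rule subset_trans)
    then obtain w where "length w = length Qs" "walk (plaque_rel Cs) w x y"
      using chain_iff_walk[of "length Qs" x y] Qs(3) by blast
    then have "?n \<le> length Qs" using walk_dist_le by metis
    also have "\<dots> = card (set Qs)" using Qs(1) by (simp add: distinct_card)
    also have "\<dots> \<le> k" using card_mono[OF \<P>(2) Qs(2)] \<P>(3) by simp
    finally show ?thesis .
  qed
  obtain w where w: "walk (plaque_rel Cs) w x y" "length w = ?n" using shortest_walk y .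
  then obtain Ps where Ps: "length Ps = ?n" "set Ps \<subseteq> atlas_plaques" "walk both_in Ps x y"
    using chain_iff_walk[of ?n x y] by blast
  have "Ps \<noteq> []" using Ps(3) False by auto
  then have "connectedin (leaf_topology \<F>) (\<Union>(set Ps)) \<and> x \<in> \<Union>(set Ps) \<and> y \<in> \<Union>(set Ps)"
    using Ps by (intro connectedin_chain connectedin_atlas_plaque) auto
  then have "Q (card (set Ps)) (set Ps)" using Ps(2) unfolding Q_def by auto
  \<comment> \<open>A shortest chain has no repeated plaque: its set of plaques has at most
    \<open>?n\<close> elements, and at least \<open>?n\<close> by the lower bound.\<close>
  moreover from lower[OF this] have "card (set Ps) = ?n" using card_length[of Ps] Ps(1) by simp
  ultimately have "\<exists>\<P>. Q ?n \<P>" by auto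
  then have "(LEAST k. \<exists>\<P>. Q k \<P>) = ?n" using lower by (intro Least_equality) auto
  then show ?thesis using False unfolding plaque_dist_def Q_def by simp
qed

section \<open>Coarse types of leaves and the zero-one law\<close>

abbreviation same_coarse_type :: "'a \<Rightarrow> 'a \<Rightarrow> bool" where
  "same_coarse_type x y \<equiv>
    coarsely_quasi_isometric (leaf \<F> x) (plaque_dist \<F> \<U>) (leaf \<F> y) (plaque_dist \<F> \<U>)"

lemma same_coarse_type_iff:
  "same_coarse_type x y \<longleftrightarrow> coarsely_quasi_isometric
    (orbit (plaque_rel Cs) x) orbit_dist (orbit (plaque_rel Cs) y) orbit_dist"
proof -
  have "plaque_dist \<F> \<U> p q = orbit_dist p q"
    if "p \<in> orbit (plaque_rel Cs) z" "q \<in> orbit (plaque_rel Cs) z" for p q z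
    using plaque_dist_eq orbit_eq[of "plaque_rel Cs", OF r_sym that(1)] that(2) by blast
  then show ?thesis unfolding leaf_eq_orbit
    by (intro iffI) (erule coarsely_quasi_isometric_cong; simp)+
qed

lemma same_coarse_type_sym: "same_coarse_type x y \<Longrightarrow> same_coarse_type y x"
  unfolding same_coarse_type_iff using coarsely_quasi_isometric_sym orbit_pseudometric by blast

lemma same_coarse_type_trans: "same_coarse_type x y \<Longrightarrow> same_coarse_type y z \<Longrightarrow> same_coarse_type x z"
  unfolding same_coarse_type_iff using coarsely_quasi_isometric_trans orbit_pseudometric by blast

lemma measurable_same_coarse_type: "{y. same_coarse_type x y} \<in> sets borel"
  unfolding same_coarse_type_iff by (rule measurable_coarse_type)

lemma saturated_same_coarse_type: "saturated \<F> {y. same_coarse_type x y}"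
  unfolding saturated_def
proof (intro exI conjI)
  let ?Y = "{y. same_coarse_type x y}"
  show "leaf \<F> ` ?Y \<subseteq> leaves \<F>"
    unfolding leaves_def leaf_def connected_components_of_def topspace_leaf_topology by blast
  have "leaf \<F> y \<subseteq> ?Y" if "y \<in> ?Y" for y
  proof
    fix z assume "z \<in> leaf \<F> y"
    then have "leaf \<F> z = leaf \<F> y"
      using orbit_eq[of "plaque_rel Cs", OF r_sym] unfolding leaf_eq_orbit by blast
    then show "z \<in> ?Y" using that by simp
  qed
  moreover have "y \<in> leaf \<F> y" for y unfolding leaf_eq_orbit by (rule orbit_refl)
  ultimately show "?Y = \<Union>(leaf \<F> ` ?Y)" by blast
qed

lemma coarse_type_dichotomy:
  assumes sets: "sets \<mu> = sets borel" and erg: "ergodic \<F> \<mu>"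
  shows "(AE x in \<mu>. AE y in \<mu>. same_coarse_type x y) \<or>
    (AE x in \<mu>. AE y in \<mu>. \<not> same_coarse_type x y)"
proof -
  have space: "space \<mu> = UNIV" using sets_eq_imp_space_eq[OF sets] by simp
  have zero_one: "{y. same_coarse_type x y} \<in> null_sets \<mu> \<or> - {y. same_coarse_type x y} \<in> null_sets \<mu>" for x
    using erg measurable_same_coarse_type[of x] saturated_same_coarse_type[of x]
    unfolding ergodic_def sets space Compl_eq_Diff_UNIV by blast
  show ?thesis
  proof (cases "\<exists>x. - {y. same_coarse_type x y} \<in> null_sets \<mu>")
    case True
    then obtain x where "- {y. same_coarse_type x y} \<in> null_sets \<mu>" by blast
    from AE_not_in[OF this] have ae: "AE y in \<mu>. same_coarse_type x y" by simp
    have "AE y in \<mu>. same_coarse_type z y" if z: "same_coarse_type x z" for z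
      using ae by (rule eventually_mono) (rule same_coarse_type_trans[OF same_coarse_type_sym[OF z]])
    \<comment> \<open>The conull class of \<open>x\<close> is used twice: it contains almost every
      \<open>z\<close>, and for each such \<open>z\<close> almost every \<open>y\<close> has the
      type of \<open>z\<close>.\<close>
    then have "AE z in \<mu>. AE y in \<mu>. same_coarse_type z y"
      using ae by (rule eventually_mono[rotated])
    then show ?thesis ..
  next
    case False
    then have "{y. same_coarse_type x y} \<in> null_sets \<mu>" for x using zero_one[of x] by blast
    from AE_not_in[OF this] have "AE y in \<mu>. \<not> same_coarse_type x y" for x by simp
    then show ?thesis by simp
  qed
qed

end

theorem theorem10p13:
  fixes \<F> \<U> :: "('a::{t2_space, second_countable_topology}, 'n::finite, 'z) fchart set"
    and m :: "('a, 'n, 'z) density \<Rightarrow> real"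
    and \<omega> :: "('a, 'n, 'z) density"
    and \<mu> :: "'a measure"
  assumes "compact (UNIV :: 'a set)"
    and "foliated_structure \<F>"
    and "regular_atlas \<F> \<U>"
    and "current \<F> m" and "quasi_invariant \<F> m"
    and "positive_density \<F> \<omega>" and "current_measure m \<omega> \<mu>"
    and "ergodic \<F> \<mu>"
    and "AE x in \<mu>. x \<in> leaves_without_holonomy \<F> \<U>"
  shows "(AE x in \<mu>. AE y in \<mu>.
            coarsely_quasi_isometric
              (leaf \<F> x) (plaque_dist \<F> \<U>) (leaf \<F> y) (plaque_dist \<F> \<U>)) \<or>
         (AE x in \<mu>. AE y in \<mu>.
            \<not> coarsely_quasi_isometric
              (leaf \<F> x) (plaque_dist \<F> \<U>) (leaf \<F> y) (plaque_dist \<F> \<U>))"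
proof -
  \<comment> \<open>Compactness enters here: the nonempty charts are finitely many and can be
    numbered.\<close>
  obtain Cs where Cs: "set Cs = {C \<in> \<U>. fdom C \<noteq> {}}"
    using finite_list[OF finite_nonempty_charts[OF assms(1,3)]] by blast
  have "regular_foliation \<F> \<U> Cs" using assms(2,3) Cs by (rule regular_foliation.intro)
  moreover have "sets \<mu> = sets borel"
    using assms(7) unfolding current_measure_def radon_measure_def by (elim conjE)
  ultimately show ?thesis using assms(8) by (rule regular_foliation.coarse_type_dichotomy)
qed

end
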